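(* Let $k$ be a field and let $\mathcal{C}$ be a 2-$k$-module. Suppose there are a set $I$, a family of objects $x_i\in\mathcal{C}$ ($i\in I$) and a family of functors $f_i\in\mathcal{C}^*$ ($i\in I$) such that the identity functor of $\mathcal{C}$ decomposes as $$\mathrm{id}_{\mathcal{C}}\;\cong\;\coprod_{i\in I} x_i\otimes f_i .$$ Then $\mathcal{C}$ is (equivalent as a 2-$k$-module to) a coproduct of copies of the category $\mathrm{Vect}$.
   Context: Fix a field $k$; all categories and functors are $k$-linear. $\mathrm{Vect}$ is the category of $k$-vector spaces. A 2-$k$-module is a $k$-linear locally presentable category. 2-$k$-modules form a 2-category with $k$-linear left adjoint (equivalently, cocontinuous) functors as 1-morphisms and natural transformations as 2-morphisms. The dual of $\mathcal{C}$ is $\mathcal{C}^*=\mathrm{Hom}(\mathcal{C},\mathrm{Vect})$, the category of $k$-linear left adjoint functors $\mathcal{C}\to\mathrm{Vect}$. For $x\in\mathcal{C}$ and a vector space $V$, $x\otimes V$ is the copower of $x$ by $V$ (a coproduct of copies of $x$ indexed by a basis of $V$, characterized by $\mathrm{Hom}(x\otimes V,y)\cong\mathrm{Hom}_k(V,\mathrm{Hom}(x,y))$). For $x\in\mathcal{C}$ and $f\in\mathcal{C}^*$, $x\otimes f$ denotes the endofunctor $c\mapsto x\otimes f(c)$ of $\mathcal{C}$; coproducts of such functors are computed objectwise. The coproduct of a family of 2-$k$-modules (in the 2-category of 2-$k$-modules) coincides with their product, namely the ordinary product of the underlying categories; thus a coproduct of copies of $\mathrm{Vect}$ indexed by a set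 $S$ is the category of $S$-indexed families of vector spaces. *)

theory Defs
  imports "HOL-Algebra.Module"
begin

unbundle cardinal_syntax

section \<open>Size\<close>

text \<open>
  Sets and proper classes are told apart by a Grothendieck universe, given as a set \<open>U\<close> of
  uncountable strongly inaccessible cardinality. A set, of any type, is small if its cardinality
  is less than that of \<open>U\<close>. Every small set is then in bijection with a small subset of \<open>U\<close>, so
  where small sets are quantified over they are taken to be small subsets of \<open>U\<close>.
\<close>

definition universe :: "'u set \<Rightarrow> bool" where
  "universe U \<longleftrightarrow> natLeq <o |U| \<and> regularCard |U| \<and> (\<forall>A \<subseteq> U. |A| <o |U| \<longrightarrow> |Pow A| <o |U| )"

definition small :: "'u set \<Rightarrow> 'a set \<Rightarrow> bool" where
  "small U A \<longleftrightarrow> |A| <o |U|"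


section \<open>Categories, functors and natural transformations\<close>

text \<open>
  Hom-sets for different pairs of objects need not be disjoint; hence composition and the action
  of a functor on morphisms take the relevant objects as arguments:
  \<open>Comp C x y z g f\<close> is the composite of \<open>f \<in> Mor C x y\<close> and \<open>g \<in> Mor C y z\<close>.
\<close>

record ('o, 'm) cat =
  Obj :: "'o set"
  Mor :: "'o \<Rightarrow> 'o \<Rightarrow> 'm set"
  Idt :: "'o \<Rightarrow> 'm"
  Comp :: "'o \<Rightarrow> 'o \<Rightarrow> 'o \<Rightarrow> 'm \<Rightarrow> 'm \<Rightarrow> 'm"

locale category =
  fixes C :: "('o, 'm, 'z) cat_scheme"
  assumes Idt_closed: "x \<in> Obj C \<Longrightarrow> Idt C x \<in> Mor C x x"
    and Comp_closed: "\<lbrakk>x \<in> Obj C; y \<in> Obj C; z \<in> Obj C; f \<in> Mor C x y; g \<in> Mor C y z\<rbrakk>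
      \<Longrightarrow> Comp C x y z g f \<in> Mor C x z"
    and Comp_Idt_right: "\<lbrakk>x \<in> Obj C; y \<in> Obj C; f \<in> Mor C x y\<rbrakk> \<Longrightarrow> Comp C x x y f (Idt C x) = f"
    and Comp_Idt_left: "\<lbrakk>x \<in> Obj C; y \<in> Obj C; f \<in> Mor C x y\<rbrakk> \<Longrightarrow> Comp C x y y (Idt C y) f = f"
    and Comp_assoc: "\<lbrakk>w \<in> Obj C; x \<in> Obj C; y \<in> Obj C; z \<in> Obj C;
        f \<in> Mor C w x; g \<in> Mor C x y; h \<in> Mor C y z\<rbrakk>
      \<Longrightarrow> Comp C w x z (Comp C x y z h g) f = Comp C w y z h (Comp C w x y g f)"

definition is_iso :: "('o, 'm, 'z) cat_scheme \<Rightarrow> 'o \<Rightarrow> 'o \<Rightarrow> 'm \<Rightarrow> bool" where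
  "is_iso C x y f \<longleftrightarrow> f \<in> Mor C x y \<and>
    (\<exists>g \<in> Mor C y x. Comp C x y x g f = Idt C x \<and> Comp C y x y f g = Idt C y)"

record ('o, 'm, 'p, 'n) cat_functor =
  omap :: "'o \<Rightarrow> 'p"
  amap :: "'o \<Rightarrow> 'o \<Rightarrow> 'm \<Rightarrow> 'n"

definition is_functor ::
  "('o, 'm, 'z) cat_scheme \<Rightarrow> ('p, 'n, 'y) cat_scheme \<Rightarrow> ('o, 'm, 'p, 'n) cat_functor \<Rightarrow> bool" where
  "is_functor C D F \<longleftrightarrow>
    (\<forall>x \<in> Obj C. omap F x \<in> Obj D) \<and>
    (\<forall>x \<in> Obj C. \<forall>y \<in> Obj C. \<forall>f \<in> Mor C x y. amap F x y f \<in> Mor D (omap F x) (omap F y)) \<and>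
    (\<forall>x \<in> Obj C. amap F x x (Idt C x) = Idt D (omap F x)) \<and>
    (\<forall>x \<in> Obj C. \<forall>y \<in> Obj C. \<forall>z \<in> Obj C. \<forall>f \<in> Mor C x y. \<forall>g \<in> Mor C y z.
      amap F x z (Comp C x y z g f)
        = Comp D (omap F x) (omap F y) (omap F z) (amap F y z g) (amap F x y f))"

definition id_functor :: "('o, 'm, 'o, 'm) cat_functor" where
  "id_functor = \<lparr>omap = (\<lambda>x. x), amap = (\<lambda>x y f. f)\<rparr>"

definition comp_functor ::
  "('p, 'n, 'q, 'l) cat_functor \<Rightarrow> ('o, 'm, 'p, 'n) cat_functor \<Rightarrow> ('o, 'm, 'q, 'l) cat_functor" where
  "comp_functor G F = \<lparr>omap = (\<lambda>x. omap G (omap F x)),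
     amap = (\<lambda>x y f. amap G (omap F x) (omap F y) (amap F x y f))\<rparr>"

definition is_nat_trans ::
  "('o, 'm, 'z) cat_scheme \<Rightarrow> ('p, 'n, 'y) cat_scheme \<Rightarrow>
    ('o, 'm, 'p, 'n) cat_functor \<Rightarrow> ('o, 'm, 'p, 'n) cat_functor \<Rightarrow> ('o \<Rightarrow> 'n) \<Rightarrow> bool" where
  "is_nat_trans C D F G \<tau> \<longleftrightarrow>
    (\<forall>x \<in> Obj C. \<tau> x \<in> Mor D (omap F x) (omap G x)) \<and>
    (\<forall>x \<in> Obj C. \<forall>y \<in> Obj C. \<forall>f \<in> Mor C x y.
      Comp D (omap F x) (omap F y) (omap G y) (\<tau> y) (amap F x y f)
        = Comp D (omap F x) (omap G x) (omap G y) (amap G x y f) (\<tau> x))"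

definition nat_isomorphic ::
  "('o, 'm, 'z) cat_scheme \<Rightarrow> ('p, 'n, 'y) cat_scheme \<Rightarrow>
    ('o, 'm, 'p, 'n) cat_functor \<Rightarrow> ('o, 'm, 'p, 'n) cat_functor \<Rightarrow> bool" where
  "nat_isomorphic C D F G \<longleftrightarrow>
    (\<exists>\<tau>. is_nat_trans C D F G \<tau> \<and> (\<forall>x \<in> Obj C. is_iso D (omap F x) (omap G x) (\<tau> x)))"

definition is_adjunction ::
  "('o, 'm, 'z) cat_scheme \<Rightarrow> ('p, 'n, 'y) cat_scheme \<Rightarrow>
    ('o, 'm, 'p, 'n) cat_functor \<Rightarrow> ('p, 'n, 'o, 'm) cat_functor \<Rightarrow> bool" where
  "is_adjunction C D F G \<longleftrightarrow> is_functor C D F \<and> is_functor D C G \<and>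
    (\<exists>\<phi>. (\<forall>c \<in> Obj C. \<forall>d \<in> Obj D.
           bij_betw (\<phi> c d) (Mor D (omap F c) d) (Mor C c (omap G d))) \<and>
         (\<forall>c \<in> Obj C. \<forall>c' \<in> Obj C. \<forall>d \<in> Obj D. \<forall>d' \<in> Obj D.
           \<forall>a \<in> Mor C c' c. \<forall>b \<in> Mor D d d'. \<forall>h \<in> Mor D (omap F c) d.
             \<phi> c' d' (Comp D (omap F c') d d' b (Comp D (omap F c') (omap F c) d h (amap F c' c a)))
               = Comp C c' (omap G d) (omap G d') (amap G d d' b)
                   (Comp C c' c (omap G d) (\<phi> c d h) a)))"


section \<open>Colimits\<close>

definition is_cocone ::
  "('j, 'a, 'w) cat_scheme \<Rightarrow> ('o, 'm, 'z) cat_scheme \<Rightarrow>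
    ('j, 'a, 'o, 'm) cat_functor \<Rightarrow> 'o \<Rightarrow> ('j \<Rightarrow> 'm) \<Rightarrow> bool" where
  "is_cocone J C D c \<iota> \<longleftrightarrow> c \<in> Obj C \<and> (\<forall>j \<in> Obj J. \<iota> j \<in> Mor C (omap D j) c) \<and>
    (\<forall>i \<in> Obj J. \<forall>j \<in> Obj J. \<forall>a \<in> Mor J i j.
      Comp C (omap D i) (omap D j) c (\<iota> j) (amap D i j a) = \<iota> i)"

definition is_colimit ::
  "('j, 'a, 'w) cat_scheme \<Rightarrow> ('o, 'm, 'z) cat_scheme \<Rightarrow>
    ('j, 'a, 'o, 'm) cat_functor \<Rightarrow> 'o \<Rightarrow> ('j \<Rightarrow> 'm) \<Rightarrow> bool" where
  "is_colimit J C D c \<iota> \<longleftrightarrow> is_cocone J C D c \<iota> \<and>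
    (\<forall>d \<kappa>. is_cocone J C D d \<kappa> \<longrightarrow>
      (\<exists>!g. g \<in> Mor C c d \<and> (\<forall>j \<in> Obj J. Comp C (omap D j) c d g (\<iota> j) = \<kappa> j)))"

definition is_coproduct ::
  "('o, 'm, 'z) cat_scheme \<Rightarrow> 'i set \<Rightarrow> ('i \<Rightarrow> 'o) \<Rightarrow> 'o \<Rightarrow> ('i \<Rightarrow> 'm) \<Rightarrow> bool" where
  "is_coproduct C I X c \<iota> \<longleftrightarrow> c \<in> Obj C \<and> (\<forall>i \<in> I. \<iota> i \<in> Mor C (X i) c) \<and>
    (\<forall>d \<in> Obj C. \<forall>\<kappa>. (\<forall>i \<in> I. \<kappa> i \<in> Mor C (X i) d) \<longrightarrow>
      (\<exists>!g. g \<in> Mor C c d \<and> (\<forall>i \<in> I. Comp C (X i) c d g (\<iota> i) = \<kappa> i)))"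

definition is_functor_coproduct ::
  "('o, 'm, 'z) cat_scheme \<Rightarrow> ('p, 'n, 'y) cat_scheme \<Rightarrow> 'i set \<Rightarrow>
    ('i \<Rightarrow> ('o, 'm, 'p, 'n) cat_functor) \<Rightarrow> ('o, 'm, 'p, 'n) cat_functor \<Rightarrow> bool" where
  "is_functor_coproduct C D I T G \<longleftrightarrow> is_functor C D G \<and>
    (\<exists>\<iota>. (\<forall>i \<in> I. is_nat_trans C D (T i) G (\<iota> i)) \<and>
         (\<forall>c \<in> Obj C. is_coproduct D I (\<lambda>i. omap (T i) c) (omap G c) (\<lambda>i. \<iota> i c)))"

definition cocomplete :: "'u set \<Rightarrow> ('o, 'm, 'z) cat_scheme \<Rightarrow> bool" where
  "cocomplete U C \<longleftrightarrow>
    (\<forall>(J :: ('u, 'u) cat) D.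
      category J \<and> Obj J \<subseteq> U \<and> small U (Obj J) \<and>
      (\<forall>i \<in> Obj J. \<forall>j \<in> Obj J. Mor J i j \<subseteq> U \<and> small U (Mor J i j)) \<and>
      is_functor J C D \<longrightarrow> (\<exists>c \<iota>. is_colimit J C D c \<iota>))"


section \<open>Locally presentable categories\<close>

definition poset_cat :: "'p set \<Rightarrow> 'p rel \<Rightarrow> ('p, unit) cat" where
  "poset_cat P r = \<lparr>Obj = P, Mor = (\<lambda>p q. if (p, q) \<in> r then {()} else {}),
     Idt = (\<lambda>p. ()), Comp = (\<lambda>p q s b a. ())\<rparr>"

definition directed_poset :: "'l rel \<Rightarrow> 'p set \<Rightarrow> 'p rel \<Rightarrow> bool" where
  "directed_poset \<kappa> P r \<longleftrightarrow> partial_order_on P r \<and>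
    (\<forall>X \<subseteq> P. |X| <o \<kappa> \<longrightarrow> (\<exists>q \<in> P. \<forall>p \<in> X. (p, q) \<in> r))"

text \<open>
  An object \<open>a\<close> is \<open>\<kappa>\<close>-presentable if \<open>Hom(a, -)\<close> preserves \<open>\<kappa>\<close>-directed colimits. The values
  of \<open>Hom(a, -)\<close> are sets of morphisms, not subsets of \<open>U\<close>; that the image of a colimit cocone
  is a colimit cocone of sets is therefore spelled out, with small subsets \<open>T\<close> of \<open>U\<close> as the
  sets against which the universal property is tested.
\<close>

definition presentable ::
  "'u set \<Rightarrow> 'u rel \<Rightarrow> ('o, 'm, 'z) cat_scheme \<Rightarrow> 'o \<Rightarrow> bool" where
  "presentable U \<kappa> C a \<longleftrightarrow> a \<in> Obj C \<and>
    (\<forall>P r D c \<iota>. P \<subseteq> U \<and> small U P \<and> directed_poset \<kappa> P r \<and>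
        is_functor (poset_cat P r) C D \<and> is_colimit (poset_cat P r) C D c \<iota> \<longrightarrow>
      (\<forall>T h. T \<subseteq> U \<and> small U T \<and>
          (\<forall>p \<in> P. h p \<in> Mor C a (omap D p) \<rightarrow> T) \<and>
          (\<forall>p \<in> P. \<forall>q \<in> P. (p, q) \<in> r \<longrightarrow>
            (\<forall>u \<in> Mor C a (omap D p). h q (Comp C a (omap D p) (omap D q) (amap D p q ()) u) = h p u)) \<longrightarrow>
        (\<exists>!g. g \<in> Mor C a c \<rightarrow>\<^sub>E T \<and>
          (\<forall>p \<in> P. \<forall>u \<in> Mor C a (omap D p). g (Comp C a (omap D p) c (\<iota> p) u) = h p u))))"

definition locally_small :: "'u set \<Rightarrow> ('o, 'm, 'z) cat_scheme \<Rightarrow> bool" where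
  "locally_small U C \<longleftrightarrow> (\<forall>x \<in> Obj C. \<forall>y \<in> Obj C. small U (Mor C x y))"

definition locally_presentable :: "'u set \<Rightarrow> ('o, 'm, 'z) cat_scheme \<Rightarrow> bool" where
  "locally_presentable U C \<longleftrightarrow> category C \<and> locally_small U C \<and> cocomplete U C \<and>
    (\<exists>(\<kappa> :: 'u rel) A. Cinfinite \<kappa> \<and> regularCard \<kappa> \<and> \<kappa> <o |U| \<and>
      A \<subseteq> Obj C \<and> small U A \<and> (\<forall>a \<in> A. presentable U \<kappa> C a) \<and>
      (\<forall>c \<in> Obj C. \<exists>P r D \<iota>. P \<subseteq> U \<and> small U P \<and> directed_poset \<kappa> P r \<and>
        is_functor (poset_cat P r) C D \<and> (\<forall>p \<in> P. omap D p \<in> A) \<and>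
        is_colimit (poset_cat P r) C D c \<iota>))"


section \<open>Linear categories\<close>

record ('o, 'm, 'k) lin_cat = "('o, 'm) cat" +
  mor_zero :: "'o \<Rightarrow> 'o \<Rightarrow> 'm"
  mor_add :: "'o \<Rightarrow> 'o \<Rightarrow> 'm \<Rightarrow> 'm \<Rightarrow> 'm"
  mor_smult :: "'o \<Rightarrow> 'o \<Rightarrow> 'k \<Rightarrow> 'm \<Rightarrow> 'm"

text \<open>The fields \<open>mult\<close> and \<open>one\<close> are inherited from the ring record and play no role.\<close>

definition mor_module :: "('o, 'm, 'k) lin_cat \<Rightarrow> 'o \<Rightarrow> 'o \<Rightarrow> ('k, 'm) module" where
  "mor_module C x y = \<lparr>carrier = Mor C x y, monoid.mult = (\<lambda>_ _. undefined), one = undefined,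
     zero = mor_zero C x y, add = mor_add C x y, smult = mor_smult C x y\<rparr>"

definition linear_maps ::
  "'k ring \<Rightarrow> ('k, 'a) module \<Rightarrow> ('k, 'b) module \<Rightarrow> ('a \<Rightarrow> 'b) set" where
  "linear_maps K V W = {f \<in> carrier V \<rightarrow>\<^sub>E carrier W.
     (\<forall>u \<in> carrier V. \<forall>v \<in> carrier V. f (u \<oplus>\<^bsub>V\<^esub> v) = f u \<oplus>\<^bsub>W\<^esub> f v) \<and>
     (\<forall>a \<in> carrier K. \<forall>v \<in> carrier V. f (a \<odot>\<^bsub>V\<^esub> v) = a \<odot>\<^bsub>W\<^esub> f v)}"

locale linear_category = category C for C :: "('o, 'm, 'k) lin_cat" +
  fixes K :: "'k ring"
  assumes mor_module: "\<lbrakk>x \<in> Obj C; y \<in> Obj C\<rbrakk> \<Longrightarrow> module K (mor_module C x y)"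
    and Comp_add_left: "\<lbrakk>x \<in> Obj C; y \<in> Obj C; z \<in> Obj C;
        f \<in> Mor C x y; g \<in> Mor C y z; g' \<in> Mor C y z\<rbrakk>
      \<Longrightarrow> Comp C x y z (mor_add C y z g g') f
        = mor_add C x z (Comp C x y z g f) (Comp C x y z g' f)"
    and Comp_add_right: "\<lbrakk>x \<in> Obj C; y \<in> Obj C; z \<in> Obj C;
        f \<in> Mor C x y; f' \<in> Mor C x y; g \<in> Mor C y z\<rbrakk>
      \<Longrightarrow> Comp C x y z g (mor_add C x y f f')
        = mor_add C x z (Comp C x y z g f) (Comp C x y z g f')"
    and Comp_smult_left: "\<lbrakk>x \<in> Obj C; y \<in> Obj C; z \<in> Obj C;
        f \<in> Mor C x y; g \<in> Mor C y z; a \<in> carrier K\<rbrakk>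
      \<Longrightarrow> Comp C x y z (mor_smult C y z a g) f = mor_smult C x z a (Comp C x y z g f)"
    and Comp_smult_right: "\<lbrakk>x \<in> Obj C; y \<in> Obj C; z \<in> Obj C;
        f \<in> Mor C x y; g \<in> Mor C y z; a \<in> carrier K\<rbrakk>
      \<Longrightarrow> Comp C x y z g (mor_smult C x y a f) = mor_smult C x z a (Comp C x y z g f)"

definition is_linear_functor ::
  "'k ring \<Rightarrow> ('o, 'm, 'k) lin_cat \<Rightarrow> ('p, 'n, 'k) lin_cat \<Rightarrow>
    ('o, 'm, 'p, 'n) cat_functor \<Rightarrow> bool" where
  "is_linear_functor K C D F \<longleftrightarrow> is_functor C D F \<and>
    (\<forall>x \<in> Obj C. \<forall>y \<in> Obj C.
      restrict (amap F x y) (Mor C x y)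
        \<in> linear_maps K (mor_module C x y) (mor_module D (omap F x) (omap F y)))"

definition Vect :: "'u set \<Rightarrow> 'k ring \<Rightarrow> (('k, 'u) module, 'u \<Rightarrow> 'u, 'k) lin_cat" where
  "Vect U K =
    \<lparr>Obj = {V. module K V \<and> carrier V \<subseteq> U \<and> small U (carrier V)},
     Mor = linear_maps K,
     Idt = (\<lambda>V. \<lambda>v \<in> carrier V. v),
     Comp = (\<lambda>V W X g f. compose (carrier V) g f),
     mor_zero = (\<lambda>V W. \<lambda>v \<in> carrier V. \<zero>\<^bsub>W\<^esub>),
     mor_add = (\<lambda>V W f g. \<lambda>v \<in> carrier V. f v \<oplus>\<^bsub>W\<^esub> g v),
     mor_smult = (\<lambda>V W a f. \<lambda>v \<in> carrier V. a \<odot>\<^bsub>W\<^esub> f v)\<rparr>"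

definition prod_lin_cat ::
  "'s set \<Rightarrow> ('s \<Rightarrow> ('o, 'm, 'k) lin_cat) \<Rightarrow> ('s \<Rightarrow> 'o, 's \<Rightarrow> 'm, 'k) lin_cat" where
  "prod_lin_cat S D =
    \<lparr>Obj = (\<Pi>\<^sub>E s \<in> S. Obj (D s)),
     Mor = (\<lambda>X Y. \<Pi>\<^sub>E s \<in> S. Mor (D s) (X s) (Y s)),
     Idt = (\<lambda>X. \<lambda>s \<in> S. Idt (D s) (X s)),
     Comp = (\<lambda>X Y Z g f. \<lambda>s \<in> S. Comp (D s) (X s) (Y s) (Z s) (g s) (f s)),
     mor_zero = (\<lambda>X Y. \<lambda>s \<in> S. mor_zero (D s) (X s) (Y s)),
     mor_add = (\<lambda>X Y f g. \<lambda>s \<in> S. mor_add (D s) (X s) (Y s) (f s) (g s)),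
     mor_smult = (\<lambda>X Y a f. \<lambda>s \<in> S. mor_smult (D s) (X s) (Y s) a (f s))\<rparr>"


section \<open>2-modules\<close>

definition two_module :: "'u set \<Rightarrow> 'k ring \<Rightarrow> ('o, 'm, 'k) lin_cat \<Rightarrow> bool" where
  "two_module U K C \<longleftrightarrow> linear_category C K \<and> locally_presentable U C"

definition linear_left_adjoint ::
  "'k ring \<Rightarrow> ('o, 'm, 'k) lin_cat \<Rightarrow> ('p, 'n, 'k) lin_cat \<Rightarrow>
    ('o, 'm, 'p, 'n) cat_functor \<Rightarrow> bool" where
  "linear_left_adjoint K C D F \<longleftrightarrow> is_linear_functor K C D F \<and> (\<exists>G. is_adjunction C D F G)"

definition dual_objects ::
  "'u set \<Rightarrow> 'k ring \<Rightarrow> ('o, 'm, 'k) lin_cat \<Rightarrow>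
    ('o, 'm, ('k, 'u) module, 'u \<Rightarrow> 'u) cat_functor set" where
  "dual_objects U K C = {f. linear_left_adjoint K C (Vect U K) f}"

definition two_module_equivalent ::
  "'k ring \<Rightarrow> ('o, 'm, 'k) lin_cat \<Rightarrow> ('p, 'n, 'k) lin_cat \<Rightarrow> bool" where
  "two_module_equivalent K C D \<longleftrightarrow>
    (\<exists>F G. linear_left_adjoint K C D F \<and> linear_left_adjoint K D C G \<and>
      nat_isomorphic C C (comp_functor G F) id_functor \<and>
      nat_isomorphic D D (comp_functor F G) id_functor)"

text \<open>
  The coproduct of a small family of 2-modules is the ordinary product of the underlying linear categories.
\<close>

definition coproduct_of_Vect ::
  "'u set \<Rightarrow> 'k ring \<Rightarrow> 's set \<Rightarrow> ('s \<Rightarrow> ('k, 'u) module, 's \<Rightarrow> 'u \<Rightarrow> 'u, 'k) lin_cat" where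
  "coproduct_of_Vect U K S = prod_lin_cat S (\<lambda>_. Vect U K)"

text \<open>
  The isomorphism \<open>Hom(x \<otimes> V, y) \<cong> Hom\<^sub>k(V, Hom(x, y))\<close>, natural in \<open>y\<close>, is given by its
  universal element \<open>u\<close>, a linear map from \<open>V\<close> to \<open>Hom(x, x \<otimes> V)\<close>.
\<close>

definition is_copower ::
  "'k ring \<Rightarrow> ('o, 'm, 'k) lin_cat \<Rightarrow> 'o \<Rightarrow> ('k, 'v) module \<Rightarrow> 'o \<Rightarrow> ('v \<Rightarrow> 'm) \<Rightarrow> bool" where
  "is_copower K C x V p u \<longleftrightarrow> p \<in> Obj C \<and> u \<in> linear_maps K V (mor_module C x p) \<and>
    (\<forall>y \<in> Obj C. bij_betw (\<lambda>g. \<lambda>v \<in> carrier V. Comp C x p y g (u v))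
      (Mor C p y) (linear_maps K V (mor_module C x y)))"

text \<open>
  Copowers being determined up to isomorphism, so is the endofunctor \<open>c \<mapsto> x \<otimes> f(c)\<close>; its action
  on morphisms is the one for which the universal elements are natural in \<open>c\<close>.
\<close>

definition is_tensor_functor ::
  "'k ring \<Rightarrow> ('o, 'm, 'k) lin_cat \<Rightarrow> 'o \<Rightarrow> ('o, 'm, ('k, 'v) module, 'v \<Rightarrow> 'v) cat_functor \<Rightarrow>
    ('o, 'm, 'o, 'm) cat_functor \<Rightarrow> bool" where
  "is_tensor_functor K C x f T \<longleftrightarrow> is_functor C C T \<and>
    (\<exists>u. (\<forall>c \<in> Obj C. is_copower K C x (omap f c) (omap T c) (u c)) \<and>
         (\<forall>c \<in> Obj C. \<forall>d \<in> Obj C. \<forall>a \<in> Mor C c d. \<forall>v \<in> carrier (omap f c).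
           Comp C x (omap T c) (omap T d) (amap T c d a) (u c v) = u d (amap f c d a v)))"

definition identity_decomposes ::
  "'k ring \<Rightarrow> ('o, 'm, 'k) lin_cat \<Rightarrow> 'i set \<Rightarrow> ('i \<Rightarrow> 'o) \<Rightarrow>
    ('i \<Rightarrow> ('o, 'm, ('k, 'v) module, 'v \<Rightarrow> 'v) cat_functor) \<Rightarrow> bool" where
  "identity_decomposes K C I x f \<longleftrightarrow>
    (\<exists>T G. (\<forall>i \<in> I. is_tensor_functor K C (x i) (f i) (T i)) \<and>
      is_functor_coproduct C C I T G \<and> nat_isomorphic C C id_functor G)"

end

theory Submission
  imports Defs
begin

text \<open>
  Writing \<open>w\<^sub>i(v) : x\<^sub>i \<rightarrow> c\<close> for the map given by \<open>v \<in> f\<^sub>i(c)\<close>, the decomposition says that a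
  morphism \<open>a : c \<rightarrow> d\<close> is the same as a family of linear maps \<open>h\<^sub>i : f\<^sub>i(c) \<rightarrow> Hom(x\<^sub>i, d)\<close>, through
  \<open>h\<^sub>i(v) = a w\<^sub>i(v)\<close>, while naturality gives \<open>a w\<^sub>i(v) = w\<^sub>i(f\<^sub>i(a) v)\<close>. If \<open>x\<^sub>i \<noteq> 0\<close> then \<open>w\<^sub>i\<close> is
  injective, because a linear functional on \<open>f\<^sub>i(c)\<close> that is \<open>1\<close> at \<open>v\<close> induces a retraction of
  \<open>w\<^sub>i(v)\<close>. Let \<open>S\<close> be the set of those \<open>i\<close> for which \<open>x\<^sub>i\<close> and \<open>f\<^sub>i\<close> are nonzero. Then the functor
  \<open>(f\<^sub>i)\<^sub>i\<close> from \<open>C\<close> to \<open>Vect\<^sup>S\<close> is fully faithful. For \<open>v \<noteq> 0\<close> the retraction identifies \<open>x\<^sub>i\<close> with the image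
  of an idempotent of \<open>c\<close> that has rank one on \<open>f\<^sub>i(c)\<close> and vanishes on \<open>f\<^sub>j(c)\<close> for \<open>j \<noteq> i\<close>. Hence
  \<open>f\<^sub>i(x\<^sub>i)\<close> is a line and \<open>f\<^sub>j(x\<^sub>i) = 0\<close>, and since the \<open>f\<^sub>i\<close> preserve coproducts, coproducts
  of the \<open>x\<^sub>i\<close> show that the functor is essentially surjective.
\<close>

section \<open>Bases of vector spaces\<close>

lemma linear_mapsD:
  assumes "h \<in> linear_maps K V W"
  shows "v \<in> carrier V \<Longrightarrow> h v \<in> carrier W"
    and "\<lbrakk>u \<in> carrier V; v \<in> carrier V\<rbrakk> \<Longrightarrow> h (u \<oplus>\<^bsub>V\<^esub> v) = h u \<oplus>\<^bsub>W\<^esub> h v"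
    and "\<lbrakk>a \<in> carrier K; v \<in> carrier V\<rbrakk> \<Longrightarrow> h (a \<odot>\<^bsub>V\<^esub> v) = a \<odot>\<^bsub>W\<^esub> h v"
    and "h \<in> extensional (carrier V)"
  using assms by (auto simp: linear_maps_def PiE_def)

lemma linear_maps_zero:
  assumes "module K V" "module K W" "h \<in> linear_maps K V W"
  shows "h \<zero>\<^bsub>V\<^esub> = \<zero>\<^bsub>W\<^esub>"
proof -
  interpret V: module K V by fact
  interpret W: module K W by fact
  have "h (\<zero>\<^bsub>K\<^esub> \<odot>\<^bsub>V\<^esub> \<zero>\<^bsub>V\<^esub>) = \<zero>\<^bsub>K\<^esub> \<odot>\<^bsub>W\<^esub> h \<zero>\<^bsub>V\<^esub>"
    using linear_mapsD(3)[OF assms(3)] by blast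
  then show ?thesis
    using linear_mapsD(1)[OF assms(3) V.zero_closed] by simp
qed

lemma linear_maps_eqI:
  assumes "h \<in> linear_maps K V W" "h' \<in> linear_maps K V W"
    and "\<And>v. v \<in> carrier V \<Longrightarrow> h v = h' v"
  shows "h = h'"
  using assms by (meson extensionalityI linear_mapsD(4))

text \<open>Closure under the module operations stands in for finite linear combinations, so that
  statements about spans are proved by rule induction.\<close>

inductive_set lspan :: "'k ring \<Rightarrow> ('k, 'a) module \<Rightarrow> 'a set \<Rightarrow> 'a set" for K V B where
  lspan_zero: "\<zero>\<^bsub>V\<^esub> \<in> lspan K V B"
| lspan_base: "b \<in> B \<Longrightarrow> b \<in> lspan K V B"
| lspan_add: "\<lbrakk>u \<in> lspan K V B; v \<in> lspan K V B\<rbrakk> \<Longrightarrow> u \<oplus>\<^bsub>V\<^esub> v \<in> lspan K V B"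
| lspan_smult: "\<lbrakk>a \<in> carrier K; v \<in> lspan K V B\<rbrakk> \<Longrightarrow> a \<odot>\<^bsub>V\<^esub> v \<in> lspan K V B"

lemma lspan_mono: "A \<subseteq> B \<Longrightarrow> lspan K V A \<subseteq> lspan K V B"
proof
  fix v assume "A \<subseteq> B" "v \<in> lspan K V A"
  from this(2,1) show "v \<in> lspan K V B"
    by induction (auto intro: lspan.intros)
qed

text \<open>Independence is stated as irredundance: no element lies in the span of the others. Over
  a field this is linear independence, as \<open>lspan_cancel\<close> makes explicit.\<close>

definition is_basis :: "'k ring \<Rightarrow> ('k, 'a) module \<Rightarrow> 'a set \<Rightarrow> bool" where
  "is_basis K V B \<longleftrightarrow> B \<subseteq> carrier V \<and> lspan K V B = carrier V \<and>
    (\<forall>b \<in> B. b \<notin> lspan K V (B - {b}))"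

text \<open>The ring record \<open>K\<close> is not a module over itself, so
  \<open>linear_maps\<close> cannot have it as a target; values outside the carrier are left
  free.\<close>

definition linear_functional :: "'k ring \<Rightarrow> ('k, 'a) module \<Rightarrow> ('a \<Rightarrow> 'k) \<Rightarrow> bool" where
  "linear_functional K V l \<longleftrightarrow> l \<in> carrier V \<rightarrow> carrier K \<and>
    (\<forall>u \<in> carrier V. \<forall>v \<in> carrier V. l (u \<oplus>\<^bsub>V\<^esub> v) = l u \<oplus>\<^bsub>K\<^esub> l v) \<and>
    (\<forall>a \<in> carrier K. \<forall>v \<in> carrier V. l (a \<odot>\<^bsub>V\<^esub> v) = a \<otimes>\<^bsub>K\<^esub> l v)"

lemma linear_functionalD:
  assumes "linear_functional K V l"
  shows "v \<in> carrier V \<Longrightarrow> l v \<in> carrier K"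
    and "\<lbrakk>u \<in> carrier V; v \<in> carrier V\<rbrakk> \<Longrightarrow> l (u \<oplus>\<^bsub>V\<^esub> v) = l u \<oplus>\<^bsub>K\<^esub> l v"
    and "\<lbrakk>a \<in> carrier K; v \<in> carrier V\<rbrakk> \<Longrightarrow> l (a \<odot>\<^bsub>V\<^esub> v) = a \<otimes>\<^bsub>K\<^esub> l v"
  using assms by (auto simp: linear_functional_def)

locale field_module = module K V + field K for K :: "'k ring" and V :: "('k, 'a) module"
begin

lemma lspan_closed:
  assumes "B \<subseteq> carrier V"
  shows "v \<in> lspan K V B \<Longrightarrow> v \<in> carrier V"
  by (induction rule: lspan.induct) (use assms in auto)

text \<open>The vectors of the form on the right contain the generators and are closed under the
  operations. Splitting off one coefficient drives both the Zorn step and the coordinate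
  functionals.\<close>

lemma lspan_insert:
  assumes "insert b B \<subseteq> carrier V" "v \<in> lspan K V (insert b B)"
  shows "\<exists>a \<in> carrier K. \<exists>h \<in> lspan K V B. v = a \<odot>\<^bsub>V\<^esub> b \<oplus>\<^bsub>V\<^esub> h"
  using assms(2)
proof induction
  case lspan_zero
  have "\<zero>\<^bsub>V\<^esub> = \<zero>\<^bsub>K\<^esub> \<odot>\<^bsub>V\<^esub> b \<oplus>\<^bsub>V\<^esub> \<zero>\<^bsub>V\<^esub>" using assms(1) by simp
  then show ?case by (metis lspan.lspan_zero R.zero_closed)
next
  case (lspan_base c)
  show ?case
  proof (cases "c = b")
    case True
    have "b = \<one>\<^bsub>K\<^esub> \<odot>\<^bsub>V\<^esub> b \<oplus>\<^bsub>V\<^esub> \<zero>\<^bsub>V\<^esub>" using assms(1) by simp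
    then show ?thesis using True by (metis lspan.lspan_zero R.one_closed)
  next
    case False
    then have "c \<in> B" using lspan_base by auto
    then have "c = \<zero>\<^bsub>K\<^esub> \<odot>\<^bsub>V\<^esub> b \<oplus>\<^bsub>V\<^esub> c" using assms(1) by auto
    then show ?thesis using \<open>c \<in> B\<close> by (metis lspan.lspan_base R.zero_closed)
  qed
next
  case (lspan_add u v)
  then obtain a h a' h' where
    *: "a \<in> carrier K" "h \<in> lspan K V B" "u = a \<odot>\<^bsub>V\<^esub> b \<oplus>\<^bsub>V\<^esub> h"
      "a' \<in> carrier K" "h' \<in> lspan K V B" "v = a' \<odot>\<^bsub>V\<^esub> b \<oplus>\<^bsub>V\<^esub> h'" by blast
  have "h \<in> carrier V" "h' \<in> carrier V" using lspan_closed assms(1) * by auto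
  then have "u \<oplus>\<^bsub>V\<^esub> v = (a \<oplus>\<^bsub>K\<^esub> a') \<odot>\<^bsub>V\<^esub> b \<oplus>\<^bsub>V\<^esub> (h \<oplus>\<^bsub>V\<^esub> h')"
    using * assms(1) by (simp add: smult_l_distr M.a_ac)
  then show ?case using * by (meson lspan.lspan_add R.a_closed)
next
  case (lspan_smult c v)
  then obtain a h where
    *: "a \<in> carrier K" "h \<in> lspan K V B" "v = a \<odot>\<^bsub>V\<^esub> b \<oplus>\<^bsub>V\<^esub> h" by blast
  have "h \<in> carrier V" using lspan_closed assms(1) * by auto
  then have "c \<odot>\<^bsub>V\<^esub> v = (c \<otimes>\<^bsub>K\<^esub> a) \<odot>\<^bsub>V\<^esub> b \<oplus>\<^bsub>V\<^esub> (c \<odot>\<^bsub>V\<^esub> h)"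
    using * assms(1) lspan_smult(1) by (simp add: smult_r_distr smult_assoc1)
  then show ?case using * lspan_smult(1) by (meson lspan.lspan_smult R.m_closed)
qed

text \<open>Subtract \<open>h\<close>, then divide by \<open>a\<close>. This exchange step is where
  inverses of scalars enter.\<close>

lemma lspan_cancel:
  assumes "B \<subseteq> carrier V" "v \<in> carrier V" "a \<in> carrier K" "a \<noteq> \<zero>\<^bsub>K\<^esub>"
    and "h \<in> lspan K V B" "a \<odot>\<^bsub>V\<^esub> v \<oplus>\<^bsub>V\<^esub> h \<in> lspan K V B"
  shows "v \<in> lspan K V B"
proof -
  let ?i = "inv\<^bsub>K\<^esub> a" and ?w = "a \<odot>\<^bsub>V\<^esub> v \<oplus>\<^bsub>V\<^esub> h"
  have i: "?i \<in> carrier K" "?i \<otimes>\<^bsub>K\<^esub> a = \<one>\<^bsub>K\<^esub>"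
    using assms(3,4) field_Units by auto
  have h: "h \<in> carrier V" using lspan_closed assms by auto
  have "?w \<oplus>\<^bsub>V\<^esub> (\<ominus>\<^bsub>K\<^esub> \<one>\<^bsub>K\<^esub>) \<odot>\<^bsub>V\<^esub> h = a \<odot>\<^bsub>V\<^esub> v"
    using h assms by (simp add: smult_l_minus M.a_assoc M.r_neg)
  then have "?i \<odot>\<^bsub>V\<^esub> (?w \<oplus>\<^bsub>V\<^esub> (\<ominus>\<^bsub>K\<^esub> \<one>\<^bsub>K\<^esub>) \<odot>\<^bsub>V\<^esub> h) = v"
    using i assms by (simp flip: smult_assoc1)
  moreover have "?i \<odot>\<^bsub>V\<^esub> (?w \<oplus>\<^bsub>V\<^esub> (\<ominus>\<^bsub>K\<^esub> \<one>\<^bsub>K\<^esub>) \<odot>\<^bsub>V\<^esub> h) \<in> lspan K V B"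
    using i(1) assms(5) by (intro lspan_smult[of _ K] lspan_add[OF assms(6)]) auto
  ultimately show ?thesis by simp
qed

text \<open>Zorn's lemma for the independent sets containing \<open>A\<close>; a maximal one spans,
  because a vector outside its span could be adjoined.\<close>

lemma basis_extends:
  assumes A: "A \<subseteq> carrier V" "\<forall>b \<in> A. b \<notin> lspan K V (A - {b})"
  shows "\<exists>B. A \<subseteq> B \<and> is_basis K V B"
proof -
  let ?A = "{B. A \<subseteq> B \<and> B \<subseteq> carrier V \<and> (\<forall>b \<in> B. b \<notin> lspan K V (B - {b}))}"
  have "\<exists>M \<in> ?A. \<forall>X \<in> ?A. M \<subseteq> X \<longrightarrow> X = M"
  proof (rule subset_Zorn_nonempty)
    show "?A \<noteq> {}" using A by blast
  next
    fix \<C> assume ne: "\<C> \<noteq> {}" and ch: "subset.chain ?A \<C>"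
    have sub: "\<C> \<subseteq> ?A" and lin: "\<And>X Y. X \<in> \<C> \<Longrightarrow> Y \<in> \<C> \<Longrightarrow> X \<subseteq> Y \<or> Y \<subseteq> X"
      using ch by (auto simp: subset_chain_def)
    \<comment> \<open>Independence of the union is the case \<open>v = b\<close>; the variable
      \<open>v\<close> makes rule induction possible. Each element of the span uses finitely many
      generators, so one member of the chain already contains them, and it can be chosen to contain
      \<open>b\<close> too.\<close>
    have "v \<noteq> b" if b: "b \<in> \<Union>\<C>" and v: "v \<in> lspan K V (\<Union>\<C> - {b})" for b v
    proof -
      obtain X0 where X0: "X0 \<in> \<C>" "b \<in> X0" using b by blast
      from v have "\<exists>X \<in> \<C>. b \<in> X \<and> v \<in> lspan K V (X - {b})"
      proof induction
        case (lspan_base c)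
        then obtain Y where Y: "Y \<in> \<C>" "c \<in> Y" "c \<noteq> b" by blast
        then have "X0 \<subseteq> Y \<or> Y \<subseteq> X0" using X0 lin by blast
        then show ?case
          using Y X0 by (metis DiffI lspan.lspan_base singletonD subsetD)
      next
        case (lspan_add u v)
        then obtain X Y where "X \<in> \<C>" "b \<in> X" "u \<in> lspan K V (X - {b})"
          "Y \<in> \<C>" "b \<in> Y" "v \<in> lspan K V (Y - {b})" by blast
        moreover from this obtain Z where "Z \<in> \<C>" "b \<in> Z" "X \<subseteq> Z" "Y \<subseteq> Z"
          using lin by blast
        ultimately have "u \<in> lspan K V (Z - {b})" "v \<in> lspan K V (Z - {b})"
          using lspan_mono[of "X - {b}" "Z - {b}"] lspan_mono[of "Y - {b}" "Z - {b}"] by blast+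
        then show ?case
          using \<open>Z \<in> \<C>\<close> \<open>b \<in> Z\<close> by (blast intro: lspan.lspan_add)
      qed (use X0 in \<open>auto intro: lspan.intros\<close>)
      then show ?thesis using sub by blast
    qed
    then show "\<Union>\<C> \<in> ?A" using sub ne by blast
  qed
  then obtain B where BA: "B \<in> ?A" and max: "\<forall>X \<in> ?A. B \<subseteq> X \<longrightarrow> X = B" by (rule bexE)
  have AB: "A \<subseteq> B" and B: "B \<subseteq> carrier V" "\<forall>b \<in> B. b \<notin> lspan K V (B - {b})"
    using BA by auto
  have "v \<in> lspan K V B" if v: "v \<in> carrier V" for v
  proof (rule ccontr)
    assume n: "v \<notin> lspan K V B"
    then have vB: "v \<notin> B" by (auto intro: lspan_base)
    \<comment> \<open>In a relation expressing \<open>c\<close> through \<open>v\<close> and the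
      other elements, a nonzero coefficient of \<open>v\<close> puts \<open>v\<close> into the span
      of \<open>B\<close>, and a zero coefficient contradicts the independence of
      \<open>B\<close>.\<close>
    have "c \<notin> lspan K V (insert v B - {c})" if c: "c \<in> insert v B" for c
    proof (cases "c = v")
      case True
      then show ?thesis using n vB by simp
    next
      case False
      then have cB: "c \<in> B" and eq: "insert v B - {c} = insert v (B - {c})"
        using c by auto
      show ?thesis
      proof
        assume "c \<in> lspan K V (insert v B - {c})"
        then obtain a h where a: "a \<in> carrier K" and h: "h \<in> lspan K V (B - {c})"
          and ce: "c = a \<odot>\<^bsub>V\<^esub> v \<oplus>\<^bsub>V\<^esub> h"
          using lspan_insert[of v "B - {c}" c] B v unfolding eq by auto
        have hV: "h \<in> carrier V" using lspan_closed[of "B - {c}" h] B h by auto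
        show False
        proof (cases "a = \<zero>\<^bsub>K\<^esub>")
          case True
          then have "c = h" using ce hV v by simp
          then show ?thesis using h B cB by blast
        next
          case False
          have "h \<in> lspan K V B" using h lspan_mono[of "B - {c}" B] by blast
          then show ?thesis
            using lspan_cancel[of B v a h] B v a False ce cB n by (metis lspan_base)
        qed
      qed
    qed
    then have "insert v B \<in> ?A" using AB B v by auto
    then have "insert v B = B" by (rule max[THEN bspec, THEN mp, OF _ subset_insertI])
    then show False using vB by blast
  qed
  then have "lspan K V B = carrier V" using lspan_closed[OF B(1)] by auto
  then have "is_basis K V B" using B by (simp add: is_basis_def)
  then show ?thesis using AB by blast
qed

lemma basis_exists: "\<exists>B. is_basis K V B"
  using basis_extends[of "{}"] by blast

text \<open>Every vector is uniquely \<open>a\<close> times \<open>b\<close> plus an element of the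
  span of the other basis vectors; the functional reads off \<open>a\<close>, and is linear because
  such decompositions can be added and scaled.\<close>

lemma coordinate_functional:
  assumes B: "is_basis K V B" and b: "b \<in> B"
  shows "\<exists>l. linear_functional K V l \<and> (\<forall>c \<in> B. l c = (if c = b then \<one>\<^bsub>K\<^esub> else \<zero>\<^bsub>K\<^esub>))"
proof -
  let ?H = "lspan K V (B - {b})"
  have BV: "B \<subseteq> carrier V" "b \<in> carrier V" "insert b (B - {b}) = B"
    using B b by (auto simp: is_basis_def)
  have HV: "h \<in> carrier V" if "h \<in> ?H" for h using lspan_closed[of "B - {b}"] that BV by auto
  have ex: "\<exists>a. a \<in> carrier K \<and> (\<exists>h \<in> ?H. v = a \<odot>\<^bsub>V\<^esub> b \<oplus>\<^bsub>V\<^esub> h)" if "v \<in> carrier V" for v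
    using lspan_insert[of b "B - {b}" v] that B BV unfolding is_basis_def by auto
  \<comment> \<open>The difference of two decompositions puts \<open>a - a'\<close> times
    \<open>b\<close> into the span of the other basis vectors, so \<open>a - a'\<close> cannot be
    invertible.\<close>
  have uniq: "a = a'" if "a \<in> carrier K" "a' \<in> carrier K" "h \<in> ?H" "h' \<in> ?H"
    "a \<odot>\<^bsub>V\<^esub> b \<oplus>\<^bsub>V\<^esub> h = a' \<odot>\<^bsub>V\<^esub> b \<oplus>\<^bsub>V\<^esub> h'" for a a' h h'
  proof (rule ccontr)
    assume n: "a \<noteq> a'"
    have "(a \<ominus>\<^bsub>K\<^esub> a') \<odot>\<^bsub>V\<^esub> b \<oplus>\<^bsub>V\<^esub> h = \<ominus>\<^bsub>V\<^esub> (a' \<odot>\<^bsub>V\<^esub> b) \<oplus>\<^bsub>V\<^esub> (a \<odot>\<^bsub>V\<^esub> b \<oplus>\<^bsub>V\<^esub> h)"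
      using that(1,2,3) HV BV by (simp add: a_minus_def smult_l_distr smult_l_minus M.a_ac)
    also have "\<dots> = h'"
      unfolding that(5) using that(2,4) HV BV by (simp add: M.r_neg1)
    finally have "(a \<ominus>\<^bsub>K\<^esub> a') \<odot>\<^bsub>V\<^esub> b \<oplus>\<^bsub>V\<^esub> h \<in> ?H" using that by simp
    moreover have "a \<ominus>\<^bsub>K\<^esub> a' \<noteq> \<zero>\<^bsub>K\<^esub>" using n that(1,2) R.minus_equality[of a "\<ominus>\<^bsub>K\<^esub> a'"] by (auto simp: a_minus_def)
    moreover have "B - {b} \<subseteq> carrier V" using BV by blast
    ultimately have "b \<in> ?H"
      using lspan_cancel[of "B - {b}" b "a \<ominus>\<^bsub>K\<^esub> a'" h] that BV by simp
    then show False using B b by (auto simp: is_basis_def)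
  qed
  define l where "l v = (THE a. a \<in> carrier K \<and> (\<exists>h \<in> ?H. v = a \<odot>\<^bsub>V\<^esub> b \<oplus>\<^bsub>V\<^esub> h))" for v
  have l: "l (a \<odot>\<^bsub>V\<^esub> b \<oplus>\<^bsub>V\<^esub> h) = a" if "a \<in> carrier K" "h \<in> ?H" for a h
    unfolding l_def using that uniq by (intro the_equality) auto
  have "linear_functional K V l"
    unfolding linear_functional_def
  proof (intro conjI ballI Pi_I)
    fix v assume "v \<in> carrier V"
    then obtain a h where v: "a \<in> carrier K" "h \<in> ?H" "v = a \<odot>\<^bsub>V\<^esub> b \<oplus>\<^bsub>V\<^esub> h" using ex by blast
    then show "l v \<in> carrier K" using l by simp
    { fix u assume "u \<in> carrier V"
      then obtain a' h' where u: "a' \<in> carrier K" "h' \<in> ?H" "u = a' \<odot>\<^bsub>V\<^esub> b \<oplus>\<^bsub>V\<^esub> h'" using ex by blast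
      have "u \<oplus>\<^bsub>V\<^esub> v = (a' \<oplus>\<^bsub>K\<^esub> a) \<odot>\<^bsub>V\<^esub> b \<oplus>\<^bsub>V\<^esub> (h' \<oplus>\<^bsub>V\<^esub> h)"
        using u v HV BV by (simp add: smult_l_distr M.a_ac)
      then show "l (u \<oplus>\<^bsub>V\<^esub> v) = l u \<oplus>\<^bsub>K\<^esub> l v" using u v l by (simp add: lspan_add) }
    { fix c assume c: "c \<in> carrier K"
      have "c \<odot>\<^bsub>V\<^esub> v = (c \<otimes>\<^bsub>K\<^esub> a) \<odot>\<^bsub>V\<^esub> b \<oplus>\<^bsub>V\<^esub> (c \<odot>\<^bsub>V\<^esub> h)"
        using c v HV BV by (simp add: smult_r_distr smult_assoc1)
      then show "l (c \<odot>\<^bsub>V\<^esub> v) = c \<otimes>\<^bsub>K\<^esub> l v" using c v l by (simp add: lspan_smult) }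
  qed
  moreover have "l c = (if c = b then \<one>\<^bsub>K\<^esub> else \<zero>\<^bsub>K\<^esub>)" if "c \<in> B" for c
  proof (cases "c = b")
    case True
    have "b = \<one>\<^bsub>K\<^esub> \<odot>\<^bsub>V\<^esub> b \<oplus>\<^bsub>V\<^esub> \<zero>\<^bsub>V\<^esub>" using BV by simp
    then show ?thesis using True l[OF R.one_closed lspan_zero] by simp
  next
    case False
    have "c = \<zero>\<^bsub>K\<^esub> \<odot>\<^bsub>V\<^esub> b \<oplus>\<^bsub>V\<^esub> c" using BV that by auto
    then show ?thesis using False l[OF R.zero_closed lspan_base[of c]] that by simp
  qed
  ultimately show ?thesis by blast
qed

lemma linear_maps_basis_eqI:
  assumes "is_basis K V B" "module K W"
    and h: "h \<in> linear_maps K V W" "h' \<in> linear_maps K V W"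
    and eq: "\<And>b. b \<in> B \<Longrightarrow> h b = h' b"
  shows "h = h'"
proof (rule linear_maps_eqI[OF h])
  fix v assume "v \<in> carrier V"
  then have "v \<in> lspan K V B" and BV: "B \<subseteq> carrier V" using assms(1) by (auto simp: is_basis_def)
  then show "h v = h' v"
  proof induction
    case lspan_zero
    show ?case by (simp add: linear_maps_zero[OF module_axioms assms(2)] h)
  qed (use eq h lspan_closed[OF BV] in \<open>auto simp: linear_mapsD\<close>)
qed

text \<open>Finiteness of the support holds for basis vectors and survives sums and multiples, hence
  holds on the whole span. It makes the sums in \<open>linear_extension\<close> legitimate.\<close>

lemma basis_coordinates:
  assumes B: "is_basis K V B"
  obtains l where "\<And>b. b \<in> B \<Longrightarrow> linear_functional K V (l b)"
    and "\<And>b c. b \<in> B \<Longrightarrow> c \<in> B \<Longrightarrow> l b c = (if c = b then \<one>\<^bsub>K\<^esub> else \<zero>\<^bsub>K\<^esub>)"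
    and "\<And>v. v \<in> carrier V \<Longrightarrow> finite {b \<in> B. l b v \<noteq> \<zero>\<^bsub>K\<^esub>}"
proof -
  obtain l where l: "\<And>b. b \<in> B \<Longrightarrow> linear_functional K V (l b)"
    "\<And>b c. b \<in> B \<Longrightarrow> c \<in> B \<Longrightarrow> l b c = (if c = b then \<one>\<^bsub>K\<^esub> else \<zero>\<^bsub>K\<^esub>)"
    using coordinate_functional[OF B] by metis
  have "finite {b \<in> B. l b v \<noteq> \<zero>\<^bsub>K\<^esub>}" if "v \<in> carrier V" for v
  proof -
    have "v \<in> lspan K V B" and BV: "B \<subseteq> carrier V" using that B by (auto simp: is_basis_def)
    then show ?thesis
    proof induction
      case lspan_zero
      have "l b \<zero>\<^bsub>V\<^esub> = \<zero>\<^bsub>K\<^esub>" if "b \<in> B" for b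
      proof -
        have "l b (\<zero>\<^bsub>K\<^esub> \<odot>\<^bsub>V\<^esub> \<zero>\<^bsub>V\<^esub>) = \<zero>\<^bsub>K\<^esub> \<otimes>\<^bsub>K\<^esub> l b \<zero>\<^bsub>V\<^esub>"
          using linear_functionalD(3)[OF l(1)[OF that]] by blast
        then show ?thesis using linear_functionalD(1)[OF l(1)[OF that], of "\<zero>\<^bsub>V\<^esub>"] by simp
      qed
      then show ?case by (simp cong: conj_cong)
    next
      case (lspan_base c)
      have "{b \<in> B. l b c \<noteq> \<zero>\<^bsub>K\<^esub>} \<subseteq> {c}" using l(2) lspan_base by (auto split: if_splits)
      then show ?case using finite_subset by blast
    next
      case (lspan_add u v)
      have "{b \<in> B. l b (u \<oplus>\<^bsub>V\<^esub> v) \<noteq> \<zero>\<^bsub>K\<^esub>} \<subseteq> {b \<in> B. l b u \<noteq> \<zero>\<^bsub>K\<^esub>} \<union> {b \<in> B. l b v \<noteq> \<zero>\<^bsub>K\<^esub>}"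
        using linear_functionalD(2)[OF l(1)] lspan_closed[OF BV] lspan_add.hyps by auto
      then show ?case using lspan_add by (meson finite_UnI finite_subset)
    next
      case (lspan_smult a v)
      have "{b \<in> B. l b (a \<odot>\<^bsub>V\<^esub> v) \<noteq> \<zero>\<^bsub>K\<^esub>} \<subseteq> {b \<in> B. l b v \<noteq> \<zero>\<^bsub>K\<^esub>}"
        using linear_functionalD(3)[OF l(1)] lspan_closed[OF BV] lspan_smult by auto
      then show ?case using lspan_smult by (meson finite_subset)
    qed
  qed
  then show ?thesis using l that by blast
qed

text \<open>The extension sends \<open>v\<close> to the finite sum of the \<open>l b v\<close>
  multiples of \<open>g b\<close>.\<close>

lemma linear_extension:
  assumes B: "is_basis K V B" and W: "module K W" and g: "g \<in> B \<rightarrow> carrier W"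
  shows "\<exists>h \<in> linear_maps K V W. \<forall>b \<in> B. h b = g b"
proof -
  interpret W: module K W by (rule W)
  obtain l where l: "\<And>b. b \<in> B \<Longrightarrow> linear_functional K V (l b)"
    and delta: "\<And>b c. b \<in> B \<Longrightarrow> c \<in> B \<Longrightarrow> l b c = (if c = b then \<one>\<^bsub>K\<^esub> else \<zero>\<^bsub>K\<^esub>)"
    and fin: "\<And>v. v \<in> carrier V \<Longrightarrow> finite {b \<in> B. l b v \<noteq> \<zero>\<^bsub>K\<^esub>}"
    using basis_coordinates[OF B] by blast
  note lK = linear_functionalD(1)[OF l]
  define s where "s A v = (\<Oplus>\<^bsub>W\<^esub>b\<in>A. l b v \<odot>\<^bsub>W\<^esub> g b)" for A v
  define supp where "supp v = {b \<in> B. l b v \<noteq> \<zero>\<^bsub>K\<^esub>}" for v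
  define h where "h = (\<lambda>v \<in> carrier V. s (supp v) v)"
  \<comment> \<open>The sum may run over any finite set containing the support; this gives
    \<open>u\<close>, \<open>v\<close> and their sum a common index set.\<close>
  have h: "h v = s A v" if "v \<in> carrier V" "finite A" "A \<subseteq> B" "supp v \<subseteq> A" for A v
  proof -
    have "s (supp v) v = s A v"
      unfolding s_def
      by (rule W.M.add.finprod_mono_neutral_cong_left)
        (use that g lK in \<open>auto simp: supp_def Pi_iff subset_iff\<close>)
    then show ?thesis using that by (simp add: h_def)
  qed
  have "h \<in> linear_maps K V W"
    unfolding linear_maps_def
  proof (safe intro!: PiE_I)
    fix v assume v: "v \<in> carrier V"
    have fv: "finite (supp v)" "supp v \<subseteq> B" using fin v by (auto simp: supp_def)
    show "h v \<in> carrier W"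
      unfolding h[OF v fv order_refl] s_def
      using fv v g lK by (intro W.M.finsum_closed) (auto simp: Pi_iff)
    { fix u assume u: "u \<in> carrier V"
      let ?A = "supp u \<union> supp v \<union> supp (u \<oplus>\<^bsub>V\<^esub> v)"
      have A: "finite ?A" "?A \<subseteq> B" using fin u v by (auto simp: supp_def)
      have "h (u \<oplus>\<^bsub>V\<^esub> v) = s ?A (u \<oplus>\<^bsub>V\<^esub> v)" by (rule h) (use A u v in auto)
      also have "\<dots> = (\<Oplus>\<^bsub>W\<^esub>b\<in>?A. l b u \<odot>\<^bsub>W\<^esub> g b \<oplus>\<^bsub>W\<^esub> l b v \<odot>\<^bsub>W\<^esub> g b)"
        unfolding s_def using A u v g lK
        by (intro W.M.finsum_cong' refl) 
          (auto simp: Pi_iff subset_iff linear_functionalD(2)[OF l] W.smult_l_distr)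
      also have "\<dots> = s ?A u \<oplus>\<^bsub>W\<^esub> s ?A v"
        unfolding s_def using A u v g lK by (intro W.M.finsum_addf) (auto simp: Pi_iff subset_iff)
      also have "s ?A u = h u" by (rule h[symmetric]) (use A u in auto)
      also have "s ?A v = h v" by (rule h[symmetric]) (use A v in auto)
      finally show "h (u \<oplus>\<^bsub>V\<^esub> v) = h u \<oplus>\<^bsub>W\<^esub> h v" . }
    { fix a assume a: "a \<in> carrier K"
      let ?A = "supp v \<union> supp (a \<odot>\<^bsub>V\<^esub> v)"
      have A: "finite ?A" "?A \<subseteq> B" using fin a v by (auto simp: supp_def)
      have "h (a \<odot>\<^bsub>V\<^esub> v) = s ?A (a \<odot>\<^bsub>V\<^esub> v)" by (rule h) (use A a v in auto)
      also have "\<dots> = (\<Oplus>\<^bsub>W\<^esub>b\<in>?A. a \<odot>\<^bsub>W\<^esub> (l b v \<odot>\<^bsub>W\<^esub> g b))"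
        unfolding s_def using A a v g lK
        by (intro W.M.finsum_cong' refl)
          (auto simp: Pi_iff subset_iff linear_functionalD(3)[OF l] W.smult_assoc1)
      also have "\<dots> = a \<odot>\<^bsub>W\<^esub> s ?A v"
        unfolding s_def using A a v g lK
        by (intro W.finsum_smult_ldistr[symmetric]) (auto simp: Pi_iff subset_iff)
      also have "s ?A v = h v" by (rule h[symmetric]) (use A v in auto)
      finally show "h (a \<odot>\<^bsub>V\<^esub> v) = a \<odot>\<^bsub>W\<^esub> h v" . }
  qed (simp add: h_def)
  moreover have "h b = g b" if b: "b \<in> B" for b
  proof -
    have bV: "b \<in> carrier V" using B b by (auto simp: is_basis_def)
    have "h b = s {b} b" using b bV delta by (intro h) (auto simp: supp_def split: if_splits)
    also have "\<dots> = g b" using b delta g by (simp add: s_def Pi_iff)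
    finally show ?thesis .
  qed
  ultimately show ?thesis by blast
qed

text \<open>A nonzero vector forms an independent singleton, so it belongs to a basis and has a
  coordinate functional.\<close>

lemma separating_functional:
  assumes v: "v \<in> carrier V" "v \<noteq> \<zero>\<^bsub>V\<^esub>"
  shows "\<exists>l. linear_functional K V l \<and> l v = \<one>\<^bsub>K\<^esub>"
proof -
  have "u = \<zero>\<^bsub>V\<^esub>" if "u \<in> lspan K V {}" for u
    using that by induction auto
  then obtain B where B: "v \<in> B" "is_basis K V B"
    using basis_extends[of "{v}"] v by auto
  then show ?thesis using coordinate_functional[of B v] by metis
qed

end

section \<open>Linear categories\<close>

lemma mor_module_simps [simp]:
  "carrier (mor_module C x y) = Mor C x y"
  "\<zero>\<^bsub>mor_module C x y\<^esub> = mor_zero C x y"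
  "f \<oplus>\<^bsub>mor_module C x y\<^esub> g = mor_add C x y f g"
  "a \<odot>\<^bsub>mor_module C x y\<^esub> f = mor_smult C x y a f"
  by (simp_all add: mor_module_def)

context linear_category
begin

lemma mor_zero_closed [simp]: "\<lbrakk>x \<in> Obj C; y \<in> Obj C\<rbrakk> \<Longrightarrow> mor_zero C x y \<in> Mor C x y"
  using abelian_monoid.zero_closed[of "mor_module C x y"] mor_module
  by (simp add: module_def abelian_group_def)

lemma mor_add_closed [simp]:
  "\<lbrakk>x \<in> Obj C; y \<in> Obj C; f \<in> Mor C x y; g \<in> Mor C x y\<rbrakk> \<Longrightarrow> mor_add C x y f g \<in> Mor C x y"
  using abelian_monoid.a_closed[of "mor_module C x y" f g] mor_module
  by (simp add: module_def abelian_group_def)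

lemma mor_smult_closed [simp]:
  "\<lbrakk>x \<in> Obj C; y \<in> Obj C; a \<in> carrier K; f \<in> Mor C x y\<rbrakk> \<Longrightarrow> mor_smult C x y a f \<in> Mor C x y"
  using module.smult_closed[OF mor_module, of x y a f] by simp

lemma mor_smult_zero:
  "\<lbrakk>x \<in> Obj C; y \<in> Obj C; f \<in> Mor C x y\<rbrakk> \<Longrightarrow> mor_smult C x y \<zero>\<^bsub>K\<^esub> f = mor_zero C x y"
  using module.smult_l_null[OF mor_module, of x y f] by simp

lemma mor_smult_one:
  "\<lbrakk>x \<in> Obj C; y \<in> Obj C; f \<in> Mor C x y\<rbrakk> \<Longrightarrow> mor_smult C x y \<one>\<^bsub>K\<^esub> f = f"
  using module.smult_one[OF mor_module, of x y f] by simp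

lemma Comp_zero_right:
  assumes "x \<in> Obj C" "y \<in> Obj C" "z \<in> Obj C" "g \<in> Mor C y z"
  shows "Comp C x y z g (mor_zero C x y) = mor_zero C x z"
proof -
  interpret module K "mor_module C y z" using mor_module assms by simp
  have "Comp C x y z g (mor_smult C x y \<zero>\<^bsub>K\<^esub> (mor_zero C x y))
    = mor_smult C x z \<zero>\<^bsub>K\<^esub> (Comp C x y z g (mor_zero C x y))"
    using assms by (intro Comp_smult_right) auto
  then show ?thesis using assms by (simp add: mor_smult_zero Comp_closed)
qed

end

lemma linear_mapsI:
  assumes "h \<in> extensional (carrier V)"
    and "\<And>v. v \<in> carrier V \<Longrightarrow> h v \<in> carrier W"
    and "\<And>u v. \<lbrakk>u \<in> carrier V; v \<in> carrier V\<rbrakk> \<Longrightarrow> h (u \<oplus>\<^bsub>V\<^esub> v) = h u \<oplus>\<^bsub>W\<^esub> h v"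
    and "\<And>a v. \<lbrakk>a \<in> carrier K; v \<in> carrier V\<rbrakk> \<Longrightarrow> h (a \<odot>\<^bsub>V\<^esub> v) = a \<odot>\<^bsub>W\<^esub> h v"
  shows "h \<in> linear_maps K V W"
  using assms by (auto simp: linear_maps_def PiE_def)

section \<open>Vector spaces as a linear category\<close>

lemma Vect_simps [simp]:
  "Obj (Vect U K) = {V. module K V \<and> carrier V \<subseteq> U \<and> small U (carrier V)}"
  "Mor (Vect U K) = linear_maps K"
  "Idt (Vect U K) V = (\<lambda>v \<in> carrier V. v)"
  "Comp (Vect U K) V W X g f = compose (carrier V) g f"
  "mor_zero (Vect U K) V W = (\<lambda>v \<in> carrier V. \<zero>\<^bsub>W\<^esub>)"
  "mor_add (Vect U K) V W f g = (\<lambda>v \<in> carrier V. f v \<oplus>\<^bsub>W\<^esub> g v)"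
  "mor_smult (Vect U K) V W a f = (\<lambda>v \<in> carrier V. a \<odot>\<^bsub>W\<^esub> f v)"
  by (simp_all add: Vect_def)

lemma module_closed:
  assumes "module K V"
  shows "\<zero>\<^bsub>V\<^esub> \<in> carrier V"
    and "\<lbrakk>u \<in> carrier V; v \<in> carrier V\<rbrakk> \<Longrightarrow> u \<oplus>\<^bsub>V\<^esub> v \<in> carrier V"
    and "\<lbrakk>a \<in> carrier K; v \<in> carrier V\<rbrakk> \<Longrightarrow> a \<odot>\<^bsub>V\<^esub> v \<in> carrier V"
proof -
  interpret module K V by fact
  show "\<zero>\<^bsub>V\<^esub> \<in> carrier V"
    and "\<lbrakk>u \<in> carrier V; v \<in> carrier V\<rbrakk> \<Longrightarrow> u \<oplus>\<^bsub>V\<^esub> v \<in> carrier V"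
    and "\<lbrakk>a \<in> carrier K; v \<in> carrier V\<rbrakk> \<Longrightarrow> a \<odot>\<^bsub>V\<^esub> v \<in> carrier V"
    by auto
qed

lemma module_linear_maps:
  assumes V: "module K V" and W: "module K W"
  shows "module K (mor_module (Vect U K) V W)"
proof -
  interpret V: module K V by (rule V)
  interpret W: module K W by (rule W)
  note lin = linear_mapsD
  have add: "(\<lambda>v \<in> carrier V. f v \<oplus>\<^bsub>W\<^esub> g v) \<in> linear_maps K V W"
    if "f \<in> linear_maps K V W" "g \<in> linear_maps K V W" for f g
    using lin(1-3)[OF that(1)] lin(1-3)[OF that(2)]
    by (intro linear_mapsI) (simp_all add: W.M.a_ac W.smult_r_distr)
  have zero: "(\<lambda>v \<in> carrier V. \<zero>\<^bsub>W\<^esub>) \<in> linear_maps K V W"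
    by (intro linear_mapsI) simp_all
  have smult: "(\<lambda>v \<in> carrier V. a \<odot>\<^bsub>W\<^esub> f v) \<in> linear_maps K V W"
    if "a \<in> carrier K" "f \<in> linear_maps K V W" for a f
    using that(1) lin(1-3)[OF that(2)]
    by (intro linear_mapsI)
      (simp_all add: W.smult_r_distr V.R.m_comm flip: W.smult_assoc1)
  show ?thesis
  proof (rule moduleI)
    show "cring K" by (rule V.is_cring)
    show "abelian_group (mor_module (Vect U K) V W)"
    proof (rule abelian_groupI; simp add: add zero)
      fix f g h assume "f \<in> linear_maps K V W" "g \<in> linear_maps K V W" "h \<in> linear_maps K V W"
      note l = lin(1)[OF this(1)] lin(1)[OF this(2)] lin(1)[OF this(3)]
      show "(\<lambda>v\<in>carrier V. (if v \<in> carrier V then f v \<oplus>\<^bsub>W\<^esub> g v else undefined) \<oplus>\<^bsub>W\<^esub> h v)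
        = (\<lambda>v\<in>carrier V. f v \<oplus>\<^bsub>W\<^esub> (if v \<in> carrier V then g v \<oplus>\<^bsub>W\<^esub> h v else undefined))"
        using l by (intro restrict_ext) (simp add: W.M.a_assoc)
    next
      fix f g assume "f \<in> linear_maps K V W" "g \<in> linear_maps K V W"
      note l = lin(1)[OF this(1)] lin(1)[OF this(2)]
      show "(\<lambda>v\<in>carrier V. f v \<oplus>\<^bsub>W\<^esub> g v) = (\<lambda>v\<in>carrier V. g v \<oplus>\<^bsub>W\<^esub> f v)"
        using l by (intro restrict_ext) (simp add: W.M.a_comm)
    next
      fix f assume f: "f \<in> linear_maps K V W"
      show "(\<lambda>v\<in>carrier V. (if v \<in> carrier V then \<zero>\<^bsub>W\<^esub> else undefined) \<oplus>\<^bsub>W\<^esub> f v) = f"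
        by (rule extensionalityI[OF _ lin(4)[OF f]]) (simp_all add: lin(1)[OF f])
      \<comment> \<open>The multiple by minus one serves as the additive inverse, its linearity
        being a case of \<open>smult\<close>.\<close>
      have "(\<lambda>v \<in> carrier V. (\<ominus>\<^bsub>K\<^esub> \<one>\<^bsub>K\<^esub>) \<odot>\<^bsub>W\<^esub> f v) \<in> linear_maps K V W"
        using f by (intro smult) simp_all
      moreover have "(\<lambda>v\<in>carrier V. (\<lambda>v \<in> carrier V. (\<ominus>\<^bsub>K\<^esub> \<one>\<^bsub>K\<^esub>) \<odot>\<^bsub>W\<^esub> f v) v \<oplus>\<^bsub>W\<^esub> f v)
        = (\<lambda>v\<in>carrier V. \<zero>\<^bsub>W\<^esub>)"
        using lin(1)[OF f] by (intro restrict_ext) (simp add: W.smult_l_minus W.M.l_neg)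
      ultimately show "\<exists>g\<in>linear_maps K V W. (\<lambda>v\<in>carrier V. g v \<oplus>\<^bsub>W\<^esub> f v) = (\<lambda>v\<in>carrier V. \<zero>\<^bsub>W\<^esub>)"
        by (rule bexI[where x = "\<lambda>v \<in> carrier V. (\<ominus>\<^bsub>K\<^esub> \<one>\<^bsub>K\<^esub>) \<odot>\<^bsub>W\<^esub> f v", rotated])
    qed
    fix a f assume a: "a \<in> carrier K" and "f \<in> carrier (mor_module (Vect U K) V W)"
    then have f: "f \<in> linear_maps K V W" by simp
    show "a \<odot>\<^bsub>mor_module (Vect U K) V W\<^esub> f \<in> carrier (mor_module (Vect U K) V W)"
      using smult a f by simp
    { fix b assume b: "b \<in> carrier K"
      show "(a \<oplus>\<^bsub>K\<^esub> b) \<odot>\<^bsub>mor_module (Vect U K) V W\<^esub> f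
        = a \<odot>\<^bsub>mor_module (Vect U K) V W\<^esub> f \<oplus>\<^bsub>mor_module (Vect U K) V W\<^esub> b \<odot>\<^bsub>mor_module (Vect U K) V W\<^esub> f"
        using a b lin(1)[OF f] by (auto intro!: restrict_ext simp: W.smult_l_distr)
      show "(a \<otimes>\<^bsub>K\<^esub> b) \<odot>\<^bsub>mor_module (Vect U K) V W\<^esub> f
        = a \<odot>\<^bsub>mor_module (Vect U K) V W\<^esub> (b \<odot>\<^bsub>mor_module (Vect U K) V W\<^esub> f)"
        using a b lin(1)[OF f] by (auto intro!: restrict_ext simp: W.smult_assoc1) }
    { fix g assume "g \<in> carrier (mor_module (Vect U K) V W)"
      then have g: "g \<in> linear_maps K V W" by simp
      show "a \<odot>\<^bsub>mor_module (Vect U K) V W\<^esub> (f \<oplus>\<^bsub>mor_module (Vect U K) V W\<^esub> g)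
        = a \<odot>\<^bsub>mor_module (Vect U K) V W\<^esub> f \<oplus>\<^bsub>mor_module (Vect U K) V W\<^esub> a \<odot>\<^bsub>mor_module (Vect U K) V W\<^esub> g"
        using a lin(1)[OF f] lin(1)[OF g] by (auto intro!: restrict_ext simp: W.smult_r_distr) }
  next
    fix f assume "f \<in> carrier (mor_module (Vect U K) V W)"
    then have f: "f \<in> linear_maps K V W" by simp
    show "\<one>\<^bsub>K\<^esub> \<odot>\<^bsub>mor_module (Vect U K) V W\<^esub> f = f"
      using lin(1)[OF f] by (auto intro!: extensionalityI[OF _ lin(4)[OF f]])
  qed
qed

lemma linear_maps_compose:
  assumes "module K V" "f \<in> linear_maps K V W" "g \<in> linear_maps K W X"
  shows "compose (carrier V) g f \<in> linear_maps K V X"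
  using linear_mapsD(1-3)[OF assms(2)] linear_mapsD(1-3)[OF assms(3)] module_closed[OF assms(1)]
  by (intro linear_mapsI) (simp_all add: compose_def)

lemma linear_maps_id: "module K V \<Longrightarrow> (\<lambda>v \<in> carrier V. v) \<in> linear_maps K V V"
  using module_closed[of K V] by (intro linear_mapsI) simp_all

lemma linear_category_Vect: "linear_category (Vect U K) K"
proof -
  have obj: "module K V" if "V \<in> Obj (Vect U K)" for V using that by simp
  show ?thesis
  proof (intro linear_category.intro category.intro linear_category_axioms.intro)
    fix V W f assume V: "V \<in> Obj (Vect U K)" and W: "W \<in> Obj (Vect U K)" and f: "f \<in> Mor (Vect U K) V W"
    have f': "f \<in> linear_maps K V W" using f by simp
    note l = linear_mapsD[OF f']
    show "Comp (Vect U K) V V W f (Idt (Vect U K) V) = f"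
      using l by (auto simp: compose_def intro!: extensionalityI[OF _ l(4)])
    show "Comp (Vect U K) V W W (Idt (Vect U K) W) f = f"
      using l by (auto simp: compose_def intro!: extensionalityI[OF _ l(4)])
    fix X g assume X: "X \<in> Obj (Vect U K)" and g: "g \<in> Mor (Vect U K) W X"
    show "Comp (Vect U K) V W X g f \<in> Mor (Vect U K) V X"
      using linear_maps_compose[OF obj[OF V]] f g by simp
    have g': "g \<in> linear_maps K W X" using g by simp
    note lg = linear_mapsD[OF g']
    { fix Y h assume "h \<in> Mor (Vect U K) X Y"
      show "Comp (Vect U K) V W Y (Comp (Vect U K) W X Y h g) f
        = Comp (Vect U K) V X Y h (Comp (Vect U K) V W X g f)"
        using l lg by (auto simp: compose_def intro!: restrict_ext) }
    { fix f2 assume "f2 \<in> Mor (Vect U K) V W"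
      then have "f2 \<in> linear_maps K V W" by simp
      note l2 = linear_mapsD[OF this]
      show "Comp (Vect U K) V W X g (mor_add (Vect U K) V W f f2)
        = mor_add (Vect U K) V X (Comp (Vect U K) V W X g f) (Comp (Vect U K) V W X g f2)"
        using l l2 lg by (auto simp: compose_def intro!: restrict_ext) }
    { fix g2 assume "g2 \<in> Mor (Vect U K) W X"
      show "Comp (Vect U K) V W X (mor_add (Vect U K) W X g g2) f
        = mor_add (Vect U K) V X (Comp (Vect U K) V W X g f) (Comp (Vect U K) V W X g2 f)"
        using l by (auto simp: compose_def intro!: restrict_ext) }
    fix a assume "a \<in> carrier K"
    then show "Comp (Vect U K) V W X (mor_smult (Vect U K) W X a g) f
        = mor_smult (Vect U K) V X a (Comp (Vect U K) V W X g f)"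
      and "Comp (Vect U K) V W X g (mor_smult (Vect U K) V W a f)
        = mor_smult (Vect U K) V X a (Comp (Vect U K) V W X g f)"
      using l lg by (auto simp: compose_def intro!: restrict_ext)
  qed (simp_all add: linear_maps_id module_linear_maps)
qed

section \<open>Products of linear categories\<close>

lemma prod_lin_cat_simps [simp]:
  "Obj (prod_lin_cat S D) = (\<Pi>\<^sub>E s \<in> S. Obj (D s))"
  "Mor (prod_lin_cat S D) X Y = (\<Pi>\<^sub>E s \<in> S. Mor (D s) (X s) (Y s))"
  "Idt (prod_lin_cat S D) X = (\<lambda>s \<in> S. Idt (D s) (X s))"
  "Comp (prod_lin_cat S D) X Y Z g f = (\<lambda>s \<in> S. Comp (D s) (X s) (Y s) (Z s) (g s) (f s))"
  "mor_zero (prod_lin_cat S D) X Y = (\<lambda>s \<in> S. mor_zero (D s) (X s) (Y s))"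
  "mor_add (prod_lin_cat S D) X Y f g = (\<lambda>s \<in> S. mor_add (D s) (X s) (Y s) (f s) (g s))"
  "mor_smult (prod_lin_cat S D) X Y a f = (\<lambda>s \<in> S. mor_smult (D s) (X s) (Y s) a (f s))"
  by (simp_all add: prod_lin_cat_def)

lemma module_prod_lin_cat:
  assumes "cring K" and D: "\<And>s. s \<in> S \<Longrightarrow> linear_category (D s) K"
    and X: "X \<in> (\<Pi>\<^sub>E s \<in> S. Obj (D s))" and Y: "Y \<in> (\<Pi>\<^sub>E s \<in> S. Obj (D s))"
  shows "module K (mor_module (prod_lin_cat S D) X Y)"
proof -
  have M: "module K (mor_module (D s) (X s) (Y s))" if "s \<in> S" for s
    by (intro linear_category.mor_module[OF D] PiE_mem[OF X] PiE_mem[OF Y] that)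
  have ab: "abelian_group (mor_module (D s) (X s) (Y s))" if "s \<in> S" for s
    using M[OF that] by (simp add: module_def)
  then have am: "abelian_monoid (mor_module (D s) (X s) (Y s))" if "s \<in> S" for s
    using that by (simp add: abelian_group_def)
  note closed = abelian_monoid.zero_closed[OF am, simplified] abelian_monoid.a_closed[OF am, simplified]
    module.smult_closed[OF M, simplified]
  show ?thesis
  proof (rule moduleI)
    show "cring K" by fact
    show "abelian_group (mor_module (prod_lin_cat S D) X Y)"
    proof (rule abelian_groupI)
      fix f assume f: "f \<in> carrier (mor_module (prod_lin_cat S D) X Y)"
      define g where "g = (\<lambda>s \<in> S. mor_smult (D s) (X s) (Y s) (\<ominus>\<^bsub>K\<^esub> \<one>\<^bsub>K\<^esub>) (f s))"
      have one: "\<ominus>\<^bsub>K\<^esub> \<one>\<^bsub>K\<^esub> \<in> carrier K" "\<one>\<^bsub>K\<^esub> \<in> carrier K"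
        using \<open>cring K\<close> by (simp_all add: cring.axioms(1) ring.ring_simprules)
      have "mor_add (D s) (X s) (Y s) (mor_smult (D s) (X s) (Y s) (\<ominus>\<^bsub>K\<^esub> \<one>\<^bsub>K\<^esub>) (f s)) (f s)
        = mor_zero (D s) (X s) (Y s)" if s: "s \<in> S" for s
      proof -
        interpret module K "mor_module (D s) (X s) (Y s)" using M s .
        have fs: "f s \<in> carrier (mor_module (D s) (X s) (Y s))" using f s by (auto simp: PiE_mem)
        have "(\<ominus>\<^bsub>K\<^esub> \<one>\<^bsub>K\<^esub>) \<odot>\<^bsub>mor_module (D s) (X s) (Y s)\<^esub> f s \<oplus>\<^bsub>mor_module (D s) (X s) (Y s)\<^esub> f s
          = \<zero>\<^bsub>mor_module (D s) (X s) (Y s)\<^esub>"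
          by (simp only: smult_l_minus[OF R.one_closed fs] smult_one[OF fs] M.l_neg[OF fs])
        then show ?thesis by simp
      qed
      then have "g \<oplus>\<^bsub>mor_module (prod_lin_cat S D) X Y\<^esub> f = \<zero>\<^bsub>mor_module (prod_lin_cat S D) X Y\<^esub>"
        by (auto simp: g_def intro!: restrict_ext)
      moreover have "g \<in> carrier (mor_module (prod_lin_cat S D) X Y)"
        using f closed(3) one by (auto simp: g_def PiE_mem)
      ultimately show "\<exists>g \<in> carrier (mor_module (prod_lin_cat S D) X Y).
        g \<oplus>\<^bsub>mor_module (prod_lin_cat S D) X Y\<^esub> f = \<zero>\<^bsub>mor_module (prod_lin_cat S D) X Y\<^esub>" by blast
      show "\<zero>\<^bsub>mor_module (prod_lin_cat S D) X Y\<^esub> \<oplus>\<^bsub>mor_module (prod_lin_cat S D) X Y\<^esub> f = f"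
        using f abelian_monoid.l_zero[OF am] by (auto intro!: extensionalityI[of _ S] simp: PiE_iff)
    qed (auto simp: PiE_iff closed intro!: restrict_ext
        abelian_monoid.a_assoc[OF am, simplified] abelian_monoid.a_comm[OF am, simplified])
  qed (use module.smult_l_distr[OF M] module.smult_r_distr[OF M] module.smult_assoc1[OF M]
      module.smult_one[OF M] in \<open>auto simp: PiE_iff closed intro!: restrict_ext extensionalityI[of _ S]\<close>)
qed

lemma linear_category_prod:
  assumes "cring K" and D: "\<And>s. s \<in> S \<Longrightarrow> linear_category (D s) K"
  shows "linear_category (prod_lin_cat S D) K"
proof -
  have cat: "category (D s)" if "s \<in> S" for s using D[OF that] by (simp add: linear_category_def)
  show ?thesis
  proof (intro linear_category.intro category.intro linear_category_axioms.intro)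
    show "module K (mor_module (prod_lin_cat S D) X Y)"
      if "X \<in> Obj (prod_lin_cat S D)" "Y \<in> Obj (prod_lin_cat S D)" for X Y
      using module_prod_lin_cat[of K S D X Y] assms that by simp
  qed (auto simp: PiE_iff category.Comp_closed[OF cat] category.Idt_closed[OF cat]
      category.Comp_Idt_left[OF cat] category.Comp_Idt_right[OF cat]
      intro!: restrict_ext extensionalityI[of _ S] category.Comp_assoc[OF cat]
      linear_category.Comp_add_left[OF D] linear_category.Comp_add_right[OF D]
      linear_category.Comp_smult_left[OF D] linear_category.Comp_smult_right[OF D])
qed

section \<open>Fully faithful, essentially surjective functors\<close>

lemma is_functorD:
  assumes "is_functor C D F"
  shows "x \<in> Obj C \<Longrightarrow> omap F x \<in> Obj D"
    and "\<lbrakk>x \<in> Obj C; y \<in> Obj C; f \<in> Mor C x y\<rbrakk> \<Longrightarrow> amap F x y f \<in> Mor D (omap F x) (omap F y)"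
    and "x \<in> Obj C \<Longrightarrow> amap F x x (Idt C x) = Idt D (omap F x)"
    and "\<lbrakk>x \<in> Obj C; y \<in> Obj C; z \<in> Obj C; f \<in> Mor C x y; g \<in> Mor C y z\<rbrakk> \<Longrightarrow>
      amap F x z (Comp C x y z g f)
        = Comp D (omap F x) (omap F y) (omap F z) (amap F y z g) (amap F x y f)"
  using assms by (auto simp: is_functor_def)

locale linear_equivalence = C: linear_category C K + D: linear_category D K
  for C :: "('o, 'm, 'k) lin_cat" and D :: "('p, 'n, 'k) lin_cat" and K :: "'k ring" +
  fixes F :: "('o, 'm, 'p, 'n) cat_functor"
  assumes linear: "is_linear_functor K C D F"
    and faithful: "\<lbrakk>x \<in> Obj C; y \<in> Obj C\<rbrakk> \<Longrightarrow> inj_on (amap F x y) (Mor C x y)"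
    and full: "\<lbrakk>x \<in> Obj C; y \<in> Obj C; h \<in> Mor D (omap F x) (omap F y)\<rbrakk>
      \<Longrightarrow> h \<in> amap F x y ` Mor C x y"
    and essentially_surjective: "d \<in> Obj D \<Longrightarrow> \<exists>c \<in> Obj C. \<exists>b. is_iso D (omap F c) d b"
begin

lemma F_functor: "is_functor C D F"
  using linear by (simp add: is_linear_functor_def)

lemmas F_simps [simp] = is_functorD[OF F_functor]

lemma F_add:
  "\<lbrakk>x \<in> Obj C; y \<in> Obj C; f \<in> Mor C x y; g \<in> Mor C x y\<rbrakk> \<Longrightarrow> amap F x y (mor_add C x y f g)
    = mor_add D (omap F x) (omap F y) (amap F x y f) (amap F x y g)"
  using linear by (auto simp: is_linear_functor_def linear_maps_def)

lemma F_smult: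
  "\<lbrakk>x \<in> Obj C; y \<in> Obj C; f \<in> Mor C x y; a \<in> carrier K\<rbrakk> \<Longrightarrow> amap F x y (mor_smult C x y a f)
    = mor_smult D (omap F x) (omap F y) a (amap F x y f)"
  using linear by (auto simp: is_linear_functor_def linear_maps_def)

definition lift :: "'o \<Rightarrow> 'o \<Rightarrow> 'n \<Rightarrow> 'm" where
  "lift x y = inv_into (Mor C x y) (amap F x y)"

lemma lift_closed [simp]:
  "\<lbrakk>x \<in> Obj C; y \<in> Obj C; h \<in> Mor D (omap F x) (omap F y)\<rbrakk> \<Longrightarrow> lift x y h \<in> Mor C x y"
  unfolding lift_def by (intro inv_into_into full)

lemma F_lift [simp]:
  "\<lbrakk>x \<in> Obj C; y \<in> Obj C; h \<in> Mor D (omap F x) (omap F y)\<rbrakk> \<Longrightarrow> amap F x y (lift x y h) = h"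
  unfolding lift_def by (intro f_inv_into_f full)

lemma F_eqI:
  "\<lbrakk>amap F x y f = amap F x y g; x \<in> Obj C; y \<in> Obj C; f \<in> Mor C x y; g \<in> Mor C x y\<rbrakk> \<Longrightarrow> f = g"
  using faithful by (auto dest: inj_onD)

text \<open>Object, isomorphism and inverse are packed into one triple, so that a single choice
  keeps them compatible.\<close>

lemma iso_choice:
  "\<exists>g b b'. \<forall>d \<in> Obj D. g d \<in> Obj C \<and> b d \<in> Mor D (omap F (g d)) d \<and> b' d \<in> Mor D d (omap F (g d)) \<and>
    Comp D (omap F (g d)) d (omap F (g d)) (b' d) (b d) = Idt D (omap F (g d)) \<and>
    Comp D d (omap F (g d)) d (b d) (b' d) = Idt D d"
proof -
  have "\<forall>d \<in> Obj D. \<exists>p. fst p \<in> Obj C \<and> fst (snd p) \<in> Mor D (omap F (fst p)) d \<and>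
    snd (snd p) \<in> Mor D d (omap F (fst p)) \<and>
    Comp D (omap F (fst p)) d (omap F (fst p)) (snd (snd p)) (fst (snd p)) = Idt D (omap F (fst p)) \<and>
    Comp D d (omap F (fst p)) d (fst (snd p)) (snd (snd p)) = Idt D d"
    using essentially_surjective by (fastforce simp: is_iso_def)
  then obtain p where "\<forall>d \<in> Obj D. fst (p d) \<in> Obj C \<and> fst (snd (p d)) \<in> Mor D (omap F (fst (p d))) d \<and>
    snd (snd (p d)) \<in> Mor D d (omap F (fst (p d))) \<and>
    Comp D (omap F (fst (p d))) d (omap F (fst (p d))) (snd (snd (p d))) (fst (snd (p d)))
      = Idt D (omap F (fst (p d))) \<and>
    Comp D d (omap F (fst (p d))) d (fst (snd (p d))) (snd (snd (p d))) = Idt D d"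
    by (rule bchoice[THEN exE])
  then show ?thesis
    by (intro exI[of _ "\<lambda>d. fst (p d)"] exI[of _ "\<lambda>d. fst (snd (p d))"] exI[of _ "\<lambda>d. snd (snd (p d))"])
qed

text \<open>The inverse functor \<open>G\<close> sends \<open>d\<close> to the chosen
  \<open>g d\<close> and a morphism to the lift of its conjugate by the isomorphisms
  \<open>b\<close>. Equations in \<open>C\<close> are checked after applying \<open>F\<close>, by
  faithfulness. As \<open>b\<close> is invertible, \<open>G\<close> is adjoint to \<open>F\<close>
  on both sides, which makes both functors left adjoints.\<close>

lemma two_module_equivalent: "two_module_equivalent K C D"
proof -
  obtain g b b' where
    g [simp]: "\<And>d. d \<in> Obj D \<Longrightarrow> g d \<in> Obj C"
    and b [simp]: "\<And>d. d \<in> Obj D \<Longrightarrow> b d \<in> Mor D (omap F (g d)) d"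
    and b' [simp]: "\<And>d. d \<in> Obj D \<Longrightarrow> b' d \<in> Mor D d (omap F (g d))"
    and b'b [simp]: "\<And>d. d \<in> Obj D \<Longrightarrow>
      Comp D (omap F (g d)) d (omap F (g d)) (b' d) (b d) = Idt D (omap F (g d))"
    and bb' [simp]: "\<And>d. d \<in> Obj D \<Longrightarrow> Comp D d (omap F (g d)) d (b d) (b' d) = Idt D d"
    using iso_choice by metis
  note [simp] = C.Idt_closed C.Comp_closed C.Comp_Idt_left C.Comp_Idt_right C.Comp_assoc
    D.Idt_closed D.Comp_closed D.Comp_Idt_left D.Comp_Idt_right D.Comp_assoc
  \<comment> \<open>Associativity as a rewrite rule nests composites to the right and separates
    \<open>b\<close> from \<open>b'\<close>; this rule and the next cancel the pair inside a longer
    composite.\<close>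
  have bb'_cancel [simp]: "Comp D w (omap F (g d)) d (b d) (Comp D w d (omap F (g d)) (b' d) a) = a"
    if "w \<in> Obj D" "d \<in> Obj D" "a \<in> Mor D w d" for w d a
    using that by (simp flip: D.Comp_assoc)
  have b'b_cancel [simp]:
    "Comp D w d (omap F (g d)) (b' d) (Comp D w (omap F (g d)) d (b d) a) = a"
    if "w \<in> Obj D" "d \<in> Obj D" "a \<in> Mor D w (omap F (g d))" for w d a
    using that by (simp flip: D.Comp_assoc)
  define G where "G = \<lparr>omap = g, amap = (\<lambda>d e h. lift (g d) (g e)
    (Comp D (omap F (g d)) e (omap F (g e)) (b' e) (Comp D (omap F (g d)) d e h (b d))))\<rparr>"
  have oG [simp]: "omap G = g" by (simp add: G_def)
  have aG [simp]: "amap G d e h \<in> Mor C (g d) (g e)"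
    "amap F (g d) (g e) (amap G d e h)
      = Comp D (omap F (g d)) e (omap F (g e)) (b' e) (Comp D (omap F (g d)) d e h (b d))"
    if "d \<in> Obj D" "e \<in> Obj D" "h \<in> Mor D d e" for d e h
    using that by (simp_all add: G_def)
  have G: "is_functor D C G"
    unfolding is_functor_def
  proof (intro conjI ballI)
    fix d assume "d \<in> Obj D"
    then show "amap G d d (Idt D d) = Idt C (omap G d)"
      by (intro F_eqI[of "g d" "g d"]) simp_all
    fix e e' h h' assume "d \<in> Obj D" "e \<in> Obj D" "e' \<in> Obj D" "h \<in> Mor D d e" "h' \<in> Mor D e e'"
    then show "amap G d e' (Comp D d e e' h' h)
      = Comp C (omap G d) (omap G e) (omap G e') (amap G e e' h') (amap G d e h)"
      by (intro F_eqI[of "g d" "g e'"]) simp_all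
  qed simp_all
  have "is_linear_functor K D C G"
    unfolding is_linear_functor_def
  proof (intro conjI ballI G linear_mapsI)
    fix d e assume d: "d \<in> Obj D" and e: "e \<in> Obj D"
    show "restrict (amap G d e) (Mor D d e) h \<in> carrier (mor_module C (omap G d) (omap G e))"
      if "h \<in> carrier (mor_module D d e)" for h using that d e by simp
    show "restrict (amap G d e) (Mor D d e) (h \<oplus>\<^bsub>mor_module D d e\<^esub> h')
      = restrict (amap G d e) (Mor D d e) h \<oplus>\<^bsub>mor_module C (omap G d) (omap G e)\<^esub>
        restrict (amap G d e) (Mor D d e) h'"
      if "h \<in> carrier (mor_module D d e)" "h' \<in> carrier (mor_module D d e)" for h h'
      using that d e by (simp, intro F_eqI[of "g d" "g e"])
        (simp_all add: F_add D.Comp_add_left D.Comp_add_right)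
    show "restrict (amap G d e) (Mor D d e) (a \<odot>\<^bsub>mor_module D d e\<^esub> h)
      = a \<odot>\<^bsub>mor_module C (omap G d) (omap G e)\<^esub> restrict (amap G d e) (Mor D d e) h"
      if "a \<in> carrier K" "h \<in> carrier (mor_module D d e)" for a h
      using that d e by (simp, intro F_eqI[of "g d" "g e"])
        (simp_all add: F_smult D.Comp_smult_left D.Comp_smult_right)
  qed simp
  moreover have "is_adjunction C D F G"
    unfolding is_adjunction_def
  proof (intro conjI F_functor G exI ballI)
    \<comment> \<open>The transpose of \<open>F c\<close> \<rightarrow> \<open>d\<close> is the lift
      of its composite with \<open>b' d\<close>; applying \<open>F\<close> and composing with
      \<open>b d\<close> undoes this.\<close>
    let ?phi = "\<lambda>c d h. lift c (g d) (Comp D (omap F c) d (omap F (g d)) (b' d) h)"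
    show "bij_betw (?phi c d) (Mor D (omap F c) d) (Mor C c (omap G d))"
      if "c \<in> Obj C" "d \<in> Obj D" for c d
      using that
      by (intro bij_betw_byWitness[where f' = "\<lambda>a. Comp D (omap F c) (omap F (g d)) d (b d) (amap F c (g d) a)"])
        (auto intro: F_eqI[of c "g d"])
    show "?phi c' d' (Comp D (omap F c') d d' h' (Comp D (omap F c') (omap F c) d h (amap F c' c a)))
      = Comp C c' (omap G d) (omap G d') (amap G d d' h') (Comp C c' c (omap G d) (?phi c d h) a)"
      if "c \<in> Obj C" "c' \<in> Obj C" "d \<in> Obj D" "d' \<in> Obj D"
        "a \<in> Mor C c' c" "h' \<in> Mor D d d'" "h \<in> Mor D (omap F c) d" for c c' d d' a h' h
      using that by (intro F_eqI[of c' "g d'"]) simp_all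
  qed
  moreover have "is_adjunction D C G F"
    unfolding is_adjunction_def
  proof (intro conjI F_functor G exI ballI)
    \<comment> \<open>For the other adjunction the same isomorphisms act by precomposition.\<close>
    let ?phi = "\<lambda>d c h. Comp D d (omap F (g d)) (omap F c) (amap F (g d) c h) (b' d)"
    show "bij_betw (?phi d c) (Mor C (omap G d) c) (Mor D d (omap F c))"
      if "c \<in> Obj C" "d \<in> Obj D" for c d
      using that
      by (intro bij_betw_byWitness[where f' = "\<lambda>a. lift (g d) c (Comp D (omap F (g d)) d (omap F c) a (b d))"])
        (auto intro: F_eqI[of "g d" c])
  qed auto
  moreover have "nat_isomorphic C C (comp_functor G F) id_functor"
    unfolding nat_isomorphic_def is_nat_trans_def
  proof (intro exI conjI ballI)
    \<comment> \<open>The isomorphism \<open>b\<close> at \<open>F c\<close> joins two objects in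
      the image of \<open>F\<close>, so it lifts to \<open>C\<close>; the lift of \<open>b'\<close>
      is inverse to it.\<close>
    let ?t = "\<lambda>c. lift (g (omap F c)) c (b (omap F c))"
    fix c assume c: "c \<in> Obj C"
    then show "?t c \<in> Mor C (omap (comp_functor G F) c) (omap id_functor c)"
      by (simp add: comp_functor_def id_functor_def)
    show "is_iso C (omap (comp_functor G F) c) (omap id_functor c) (?t c)"
      unfolding is_iso_def
      by (intro conjI bexI[of _ "lift c (g (omap F c)) (b' (omap F c))"])
        (use c in \<open>auto simp: comp_functor_def id_functor_def
          intro: F_eqI[of c c] F_eqI[of "g (omap F c)" "g (omap F c)"]\<close>)
    fix d a assume "d \<in> Obj C" "a \<in> Mor C c d"
    then show "Comp C (omap (comp_functor G F) c) (omap (comp_functor G F) d) (omap id_functor d)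
        (?t d) (amap (comp_functor G F) c d a)
      = Comp C (omap (comp_functor G F) c) (omap id_functor c) (omap id_functor d)
        (amap id_functor c d a) (?t c)"
      using c by (intro F_eqI[of "g (omap F c)" d]) (simp_all add: comp_functor_def id_functor_def)
  qed
  moreover have "nat_isomorphic D D (comp_functor F G) id_functor"
  proof -
    have "is_iso D (omap F (g d)) d (b d)" if "d \<in> Obj D" for d
      using that by (auto simp: is_iso_def intro: bexI[of _ "b' d"])
    then show ?thesis
      unfolding nat_isomorphic_def is_nat_trans_def comp_functor_def id_functor_def
      by (intro exI[of _ b]) simp
  qed
  ultimately show ?thesis
    using linear unfolding two_module_equivalent_def linear_left_adjoint_def by blast
qed

end

section \<open>Coproducts\<close>

lemma universe_infinite: "universe U \<Longrightarrow> infinite U"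
  using infinite_iff_natLeq_ordLeq ordLess_imp_ordLeq unfolding universe_def by blast

lemma small_subset: "\<lbrakk>small U A; B \<subseteq> A\<rbrakk> \<Longrightarrow> small U B"
  unfolding small_def using card_of_mono1 ordLeq_ordLess_trans by blast

lemma small_image: "small U A \<Longrightarrow> small U (h ` A)"
  unfolding small_def using card_of_image ordLeq_ordLess_trans by blast

lemma small_finite: "\<lbrakk>universe U; finite A\<rbrakk> \<Longrightarrow> small U A"
  unfolding small_def universe_def using finite_iff_ordLess_natLeq ordLess_transitive by blast

text \<open>Brings index sets of arbitrary type into \<open>U\<close>, over which diagrams are
  quantified.\<close>

lemma small_embedding:
  assumes "small U A"
  obtains e where "inj_on e A" "e ` A \<subseteq> U"
  using assms card_of_ordLeq[of A U] ordLess_imp_ordLeq unfolding small_def by blast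

text \<open>The regular infinite cardinal of \<open>U\<close> is stable: a union of fewer than that
  many sets, each of smaller size, stays smaller.\<close>

lemma small_Sigma:
  assumes U: "universe U" and A: "small U A" and B: "\<And>a. a \<in> A \<Longrightarrow> small U (B a)"
  shows "small U (Sigma A B)"
proof -
  have "stable |U|"
    using U universe_infinite[OF U]
    by (intro regularCard_stable[OF card_of_Card_order]) (simp_all add: universe_def Field_card_of)
  then show ?thesis
    using stable_elim[of "|U|" A B] A B unfolding small_def by blast
qed

lemma is_coproductD:
  assumes "is_coproduct C J X c \<iota>"
  shows "c \<in> Obj C"
    and "j \<in> J \<Longrightarrow> \<iota> j \<in> Mor C (X j) c"
    and "\<lbrakk>d \<in> Obj C; \<And>j. j \<in> J \<Longrightarrow> \<kappa> j \<in> Mor C (X j) d\<rbrakk> \<Longrightarrow>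
      \<exists>!g. g \<in> Mor C c d \<and> (\<forall>j \<in> J. Comp C (X j) c d g (\<iota> j) = \<kappa> j)"
  using assms by (auto simp: is_coproduct_def)

text \<open>Cocompleteness speaks of shapes inside \<open>U\<close>, so \<open>J\<close> is embedded
  there and the coproduct is the colimit over the discrete category on its image.\<close>

lemma coproduct_exists:
  fixes U :: "'u set"
  assumes C: "category C" and co: "cocomplete U C" and U: "universe U"
    and J: "small U J" and X: "\<And>j. j \<in> J \<Longrightarrow> X j \<in> Obj C"
  shows "\<exists>c \<iota>. is_coproduct C J X c \<iota>"
proof -
  interpret category C by (rule C)
  obtain e where e: "inj_on e J" "e ` J \<subseteq> U" using small_embedding[OF J] .
  let ?n = "inv_into J e"
  have n [simp]: "?n (e j) = j" if "j \<in> J" for j using e that by simp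
  have inj [simp]: "e i = e j \<longleftrightarrow> i = j" if "i \<in> J" "j \<in> J" for i j
    using e that by (simp add: inj_on_eq_iff)
  \<comment> \<open>The identity of \<open>p\<close> is encoded as \<open>p\<close> itself, which
    places the hom-sets inside \<open>U\<close>.\<close>
  define P :: "('u, 'u) cat" where
    "P = \<lparr>Obj = e ` J, Mor = (\<lambda>p q. if p = q then {p} else {}), Idt = (\<lambda>p. p), Comp = (\<lambda>p q r h' h. p)\<rparr>"
  define D :: "(_, 'u, _, _) cat_functor" where "D = \<lparr>omap = (\<lambda>p. X (?n p)), amap = (\<lambda>p q h. Idt C (X (?n p)))\<rparr>"
  have "category P"
    by unfold_locales (auto simp: P_def split: if_splits)
  moreover have "is_functor P C D"
    using X by (auto simp: is_functor_def P_def D_def Idt_closed Comp_Idt_left split: if_splits)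
  moreover have "Obj P \<subseteq> U \<and> small U (Obj P)"
    using e small_image[OF J, of e] by (simp add: P_def)
  moreover have "\<forall>p \<in> Obj P. \<forall>q \<in> Obj P. Mor P p q \<subseteq> U \<and> small U (Mor P p q)"
    using e small_finite[OF U] by (auto simp: P_def)
  ultimately have "\<exists>c \<iota>. is_colimit P C D c \<iota>"
    using co[unfolded cocomplete_def, THEN spec[of _ P], THEN spec[of _ D]] by blast
  then obtain c \<iota> where c: "is_colimit P C D c \<iota>" by blast
  \<comment> \<open>A discrete shape has only identity arrows, so compatibility of a cocone is
    automatic.\<close>
  have cocone: "is_cocone P C D d \<kappa> \<longleftrightarrow> d \<in> Obj C \<and> (\<forall>j \<in> J. \<kappa> (e j) \<in> Mor C (X j) d)" for d \<kappa>
    using X by (auto simp: is_cocone_def P_def D_def Comp_Idt_right split: if_splits)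
  have "is_coproduct C J X c (\<lambda>j. \<iota> (e j))"
    unfolding is_coproduct_def
  proof (intro conjI ballI allI impI)
    show "c \<in> Obj C" and "\<And>j. j \<in> J \<Longrightarrow> \<iota> (e j) \<in> Mor C (X j) c"
      using c cocone by (auto simp: is_colimit_def)
    fix d \<kappa> assume "d \<in> Obj C" "\<forall>j \<in> J. \<kappa> j \<in> Mor C (X j) d"
    then have "is_cocone P C D d (\<lambda>p. \<kappa> (?n p))" using cocone by simp
    then have "\<exists>!g. g \<in> Mor C c d \<and> (\<forall>p \<in> Obj P. Comp C (omap D p) c d g (\<iota> p) = \<kappa> (?n p))"
      using c unfolding is_colimit_def by blast
    then show "\<exists>!g. g \<in> Mor C c d \<and> (\<forall>j \<in> J. Comp C (X j) c d g (\<iota> (e j)) = \<kappa> j)"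
      by (simp add: P_def D_def)
  qed
  then show ?thesis by blast
qed

text \<open>Transposition turns the maps from the \<open>F (X j)\<close> to \<open>d\<close> into
  maps from the \<open>X j\<close> to \<open>G d\<close>; these factor uniquely through
  \<open>c\<close>, and the factorisation is transposed back.\<close>

lemma left_adjoint_preserves_coproduct:
  assumes C: "category C" and D: "category D" and adj: "is_adjunction C D F G"
    and X: "\<And>j. j \<in> J \<Longrightarrow> X j \<in> Obj C" and c: "is_coproduct C J X c \<iota>"
  shows "is_coproduct D J (\<lambda>j. omap F (X j)) (omap F c) (\<lambda>j. amap F (X j) c (\<iota> j))"
proof -
  interpret C: category C by (rule C)
  interpret D: category D by (rule D)
  have F: "is_functor C D F" and G: "is_functor D C G" using adj by (auto simp: is_adjunction_def)
  note F = is_functorD[OF F] and G = is_functorD[OF G]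
  obtain \<phi> where bij: "\<And>c d. \<lbrakk>c \<in> Obj C; d \<in> Obj D\<rbrakk> \<Longrightarrow>
      bij_betw (\<phi> c d) (Mor D (omap F c) d) (Mor C c (omap G d))"
    and nat: "\<And>c c' d d' a b h. \<lbrakk>c \<in> Obj C; c' \<in> Obj C; d \<in> Obj D; d' \<in> Obj D;
      a \<in> Mor C c' c; b \<in> Mor D d d'; h \<in> Mor D (omap F c) d\<rbrakk> \<Longrightarrow>
      \<phi> c' d' (Comp D (omap F c') d d' b (Comp D (omap F c') (omap F c) d h (amap F c' c a)))
        = Comp C c' (omap G d) (omap G d') (amap G d d' b) (Comp C c' c (omap G d) (\<phi> c d h) a)"
    using adj unfolding is_adjunction_def by blast
  have cO: "c \<in> Obj C" and \<iota>: "\<And>j. j \<in> J \<Longrightarrow> \<iota> j \<in> Mor C (X j) c"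
    using is_coproductD[OF c] by auto
  have mem: "\<phi> a d h \<in> Mor C a (omap G d)" if "a \<in> Obj C" "d \<in> Obj D" "h \<in> Mor D (omap F a) d" for a d h
    using bij_betw_apply[OF bij] that by blast
  \<comment> \<open>Naturality in the first variable alone, obtained by taking the identity of
    \<open>d\<close> in the second.\<close>
  have nat': "\<phi> (X j) d (Comp D (omap F (X j)) (omap F c) d h (amap F (X j) c (\<iota> j)))
      = Comp C (X j) c (omap G d) (\<phi> c d h) (\<iota> j)"
    if "j \<in> J" "d \<in> Obj D" "h \<in> Mor D (omap F c) d" for j d h
    using nat[of c "X j" d d "\<iota> j" "Idt D d" h] that X cO \<iota> mem F G
    by (simp add: D.Comp_Idt_left D.Idt_closed D.Comp_closed C.Comp_Idt_left C.Comp_closed)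
  show ?thesis
    unfolding is_coproduct_def
  proof (intro conjI ballI allI impI)
    show "omap F c \<in> Obj D" and "\<And>j. j \<in> J \<Longrightarrow> amap F (X j) c (\<iota> j) \<in> Mor D (omap F (X j)) (omap F c)"
      using F cO X \<iota> by auto
    fix d \<kappa> assume d: "d \<in> Obj D" and \<kappa>: "\<forall>j \<in> J. \<kappa> j \<in> Mor D (omap F (X j)) d"
    have iff: "Comp D (omap F (X j)) (omap F c) d h (amap F (X j) c (\<iota> j)) = \<kappa> j \<longleftrightarrow>
        Comp C (X j) c (omap G d) (\<phi> c d h) (\<iota> j) = \<phi> (X j) d (\<kappa> j)"
      if "j \<in> J" "h \<in> Mor D (omap F c) d" for j h
      using that d \<kappa> X cO \<iota> F bij_betw_imp_inj_on[OF bij[of "X j" d]]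
      by (auto simp flip: nat' simp: inj_on_eq_iff D.Comp_closed)
    have "\<exists>!g. g \<in> Mor C c (omap G d) \<and>
        (\<forall>j \<in> J. Comp C (X j) c (omap G d) g (\<iota> j) = \<phi> (X j) d (\<kappa> j))"
      using d \<kappa> G(1) X mem by (intro is_coproductD(3)[OF c]) auto
    then obtain g where g: "g \<in> Mor C c (omap G d)"
        "\<And>j. j \<in> J \<Longrightarrow> Comp C (X j) c (omap G d) g (\<iota> j) = \<phi> (X j) d (\<kappa> j)"
      and uniq: "\<And>g'. \<lbrakk>g' \<in> Mor C c (omap G d);
        \<And>j. j \<in> J \<Longrightarrow> Comp C (X j) c (omap G d) g' (\<iota> j) = \<phi> (X j) d (\<kappa> j)\<rbrakk> \<Longrightarrow> g' = g"
      by blast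
    have "g \<in> \<phi> c d ` Mor D (omap F c) d"
      unfolding bij_betw_imp_surj_on[OF bij[OF cO d]] by (rule g(1))
    then obtain h where h: "h \<in> Mor D (omap F c) d" "\<phi> c d h = g" by auto
    show "\<exists>!h. h \<in> Mor D (omap F c) d \<and>
        (\<forall>j \<in> J. Comp D (omap F (X j)) (omap F c) d h (amap F (X j) c (\<iota> j)) = \<kappa> j)"
    proof (rule ex1I[of _ h])
      show "h \<in> Mor D (omap F c) d \<and>
        (\<forall>j \<in> J. Comp D (omap F (X j)) (omap F c) d h (amap F (X j) c (\<iota> j)) = \<kappa> j)"
        using h g iff by simp
      fix h' assume h': "h' \<in> Mor D (omap F c) d \<and>
        (\<forall>j \<in> J. Comp D (omap F (X j)) (omap F c) d h' (amap F (X j) c (\<iota> j)) = \<kappa> j)"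
      then have "\<phi> c d h' = g" using iff mem[OF cO d] by (intro uniq) auto
      then show "h' = h"
        using h h' by (intro inj_onD[OF bij_betw_imp_inj_on[OF bij[OF cO d]]]) auto
    qed
  qed
qed

section \<open>Decompositions of the identity\<close>

lemma ex1_implies_unique: "\<lbrakk>\<exists>!a. P a; P a; P b\<rbrakk> \<Longrightarrow> a = b"
  by blast

lemma linear_maps_inj_onI:
  assumes V: "module K V" and W: "module K W" and h: "h \<in> linear_maps K V W"
    and ker: "\<And>v. \<lbrakk>v \<in> carrier V; h v = \<zero>\<^bsub>W\<^esub>\<rbrakk> \<Longrightarrow> v = \<zero>\<^bsub>V\<^esub>"
  shows "inj_on h (carrier V)"
proof (rule inj_onI)
  interpret V: module K V by (rule V)
  interpret W: module K W by (rule W)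
  fix u v assume u: "u \<in> carrier V" and v: "v \<in> carrier V" and eq: "h u = h v"
  have mv: "(\<ominus>\<^bsub>K\<^esub> \<one>\<^bsub>K\<^esub>) \<odot>\<^bsub>V\<^esub> v \<in> carrier V" using v by simp
  have "h ((\<ominus>\<^bsub>K\<^esub> \<one>\<^bsub>K\<^esub>) \<odot>\<^bsub>V\<^esub> v \<oplus>\<^bsub>V\<^esub> u) = (\<ominus>\<^bsub>K\<^esub> \<one>\<^bsub>K\<^esub>) \<odot>\<^bsub>W\<^esub> h v \<oplus>\<^bsub>W\<^esub> h u"
    using u v mv by (simp add: linear_mapsD(2,3)[OF h])
  also have "\<dots> = \<zero>\<^bsub>W\<^esub>"
    using linear_mapsD(1)[OF h v] unfolding eq by (simp add: W.smult_l_minus W.M.l_neg)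
  finally have "(\<ominus>\<^bsub>K\<^esub> \<one>\<^bsub>K\<^esub>) \<odot>\<^bsub>V\<^esub> v \<oplus>\<^bsub>V\<^esub> u = \<zero>\<^bsub>V\<^esub>"
    using ker u mv by simp
  then have "\<ominus>\<^bsub>V\<^esub> v \<oplus>\<^bsub>V\<^esub> u = \<zero>\<^bsub>V\<^esub>" using v by (simp add: V.smult_l_minus)
  then show "u = v" using u v
    by (metis V.M.a_inv_closed V.M.minus_equality V.M.minus_minus)
qed

lemma is_iso_prod:
  assumes "\<And>s. s \<in> S \<Longrightarrow> is_iso (D s) (X s) (Y s) (h s)"
  shows "is_iso (prod_lin_cat S D) X Y (restrict h S)"
proof -
  have "\<exists>k. k \<in> Mor (D s) (Y s) (X s) \<and> Comp (D s) (X s) (Y s) (X s) k (h s) = Idt (D s) (X s) \<and>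
      Comp (D s) (Y s) (X s) (Y s) (h s) k = Idt (D s) (Y s)" if "s \<in> S" for s
    using assms[OF that] by (auto simp: is_iso_def)
  then obtain k where k: "\<And>s. s \<in> S \<Longrightarrow> k s \<in> Mor (D s) (Y s) (X s)"
    "\<And>s. s \<in> S \<Longrightarrow> Comp (D s) (X s) (Y s) (X s) (k s) (h s) = Idt (D s) (X s)"
    "\<And>s. s \<in> S \<Longrightarrow> Comp (D s) (Y s) (X s) (Y s) (h s) (k s) = Idt (D s) (Y s)"
    by metis
  show ?thesis
    unfolding is_iso_def using assms k
    by (intro conjI bexI[of _ "restrict k S"]) (auto simp: is_iso_def intro!: restrict_ext)
qed

text \<open>
  The maps \<open>w i c\<close> send \<open>v\<close> to the composite of \<open>x\<^sub>i \<rightarrow> x\<^sub>i \<otimes> f\<^sub>i(c)\<close>, the coproduct inclusion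
  and the isomorphism with \<open>c\<close>. The universal properties of copowers and coproducts
  combine to a single one, that mentions neither.
\<close>

locale dual_decomposition = linear_category C K + field K
  for C :: "('o, 'm, 'k) lin_cat" and K :: "'k ring" +
  fixes U :: "'u set" and I :: "'i set" and x :: "'i \<Rightarrow> 'o"
    and f :: "'i \<Rightarrow> ('o, 'm, ('k, 'u) module, 'u \<Rightarrow> 'u) cat_functor"
    and w :: "'i \<Rightarrow> 'o \<Rightarrow> 'u \<Rightarrow> 'm"
  assumes x_closed [simp]: "i \<in> I \<Longrightarrow> x i \<in> Obj C"
    and f_dual: "i \<in> I \<Longrightarrow> f i \<in> dual_objects U K C"
    and w_linear: "\<lbrakk>i \<in> I; c \<in> Obj C\<rbrakk> \<Longrightarrow> w i c \<in> linear_maps K (omap (f i) c) (mor_module C (x i) c)"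
    and w_natural: "\<lbrakk>i \<in> I; c \<in> Obj C; d \<in> Obj C; a \<in> Mor C c d; v \<in> carrier (omap (f i) c)\<rbrakk>
      \<Longrightarrow> Comp C (x i) c d a (w i c v) = w i d (amap (f i) c d a v)"
    and w_universal: "\<lbrakk>c \<in> Obj C; d \<in> Obj C;
        \<And>i. i \<in> I \<Longrightarrow> h i \<in> linear_maps K (omap (f i) c) (mor_module C (x i) d)\<rbrakk>
      \<Longrightarrow> \<exists>!a. a \<in> Mor C c d \<and>
        (\<forall>i \<in> I. \<forall>v \<in> carrier (omap (f i) c). Comp C (x i) c d a (w i c v) = h i v)"
begin

section \<open>Computation rules for the functors \<open>f i\<close> and the maps
  \<open>w i c\<close>\<close>

lemma f_linear: "i \<in> I \<Longrightarrow> is_linear_functor K C (Vect U K) (f i)"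
  using f_dual by (auto simp: dual_objects_def linear_left_adjoint_def)

lemma f_functor: "i \<in> I \<Longrightarrow> is_functor C (Vect U K) (f i)"
  using f_linear by (auto simp: is_linear_functor_def)

lemma f_obj: "\<lbrakk>i \<in> I; c \<in> Obj C\<rbrakk> \<Longrightarrow> omap (f i) c \<in> Obj (Vect U K)"
  using is_functorD(1)[OF f_functor] .

lemma f_module: "\<lbrakk>i \<in> I; c \<in> Obj C\<rbrakk> \<Longrightarrow> module K (omap (f i) c)"
  using f_obj by simp

lemma f_field_module: "\<lbrakk>i \<in> I; c \<in> Obj C\<rbrakk> \<Longrightarrow> field_module K (omap (f i) c)"
  using f_module by (intro field_module.intro field_axioms)

lemma f_mor: "\<lbrakk>i \<in> I; c \<in> Obj C; d \<in> Obj C; a \<in> Mor C c d\<rbrakk>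
    \<Longrightarrow> amap (f i) c d a \<in> linear_maps K (omap (f i) c) (omap (f i) d)"
  using is_functorD(2)[OF f_functor] by simp

lemmas f_mem [simp] = linear_mapsD(1)[OF f_mor]

lemma f_Idt: "\<lbrakk>i \<in> I; c \<in> Obj C; v \<in> carrier (omap (f i) c)\<rbrakk> \<Longrightarrow> amap (f i) c c (Idt C c) v = v"
  using is_functorD(3)[OF f_functor] by simp

lemma f_Comp: "\<lbrakk>i \<in> I; c \<in> Obj C; d \<in> Obj C; e \<in> Obj C; a \<in> Mor C c d; b \<in> Mor C d e;
      v \<in> carrier (omap (f i) c)\<rbrakk>
    \<Longrightarrow> amap (f i) c e (Comp C c d e b a) v = amap (f i) d e b (amap (f i) c d a v)"
  using is_functorD(4)[OF f_functor] by (simp add: compose_def)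

lemma w_closed [simp]: "\<lbrakk>i \<in> I; c \<in> Obj C; v \<in> carrier (omap (f i) c)\<rbrakk> \<Longrightarrow> w i c v \<in> Mor C (x i) c"
  using linear_mapsD(1)[OF w_linear] by simp

lemma w_zero: "\<lbrakk>i \<in> I; c \<in> Obj C\<rbrakk> \<Longrightarrow> w i c \<zero>\<^bsub>omap (f i) c\<^esub> = mor_zero C (x i) c"
  using linear_maps_zero[OF f_module mor_module w_linear] by simp

lemma w_smult: "\<lbrakk>i \<in> I; c \<in> Obj C; a \<in> carrier K; v \<in> carrier (omap (f i) c)\<rbrakk>
    \<Longrightarrow> w i c (a \<odot>\<^bsub>omap (f i) c\<^esub> v) = mor_smult C (x i) c a (w i c v)"
  using linear_mapsD(3)[OF w_linear] by simp

lemma zero_linear: "\<lbrakk>i \<in> I; d \<in> Obj C; module K V\<rbrakk>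
    \<Longrightarrow> (\<lambda>v \<in> carrier V. mor_zero C (x i) d) \<in> linear_maps K V (mor_module C (x i) d)"
proof -
  assume *: "i \<in> I" "d \<in> Obj C" "module K V"
  interpret M: module K "mor_module C (x i) d" using mor_module * by simp
  show ?thesis
    using module_closed[OF *(3)] * M.M.r_zero[of "mor_zero C (x i) d"]
      M.smult_r_null by (intro linear_mapsI) simp_all
qed

text \<open>The functor \<open>x\<^sub>i \<otimes> f\<^sub>i\<close> is nonzero exactly for the active indices.\<close>

definition active :: "'i set" where
  "active = {i \<in> I. Idt C (x i) \<noteq> mor_zero C (x i) (x i) \<and>
    (\<exists>c \<in> Obj C. \<exists>v \<in> carrier (omap (f i) c). v \<noteq> \<zero>\<^bsub>omap (f i) c\<^esub>)}"

lemma activeD: "i \<in> active \<Longrightarrow> i \<in> I"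
  by (simp add: active_def)

text \<open>The universal property is applied to the family that sends \<open>u\<close> to
  \<open>l u\<close> times the identity at index \<open>i\<close> and is zero at all others, where
  \<open>l\<close> is a functional with value one at \<open>v\<close>. Then \<open>q\<close>
  composed with \<open>w i c v\<close> is the identity.\<close>

lemma retraction:
  assumes i: "i \<in> I" and c: "c \<in> Obj C" and v: "v \<in> carrier (omap (f i) c)" "v \<noteq> \<zero>\<^bsub>omap (f i) c\<^esub>"
  obtains q l where "q \<in> Mor C c (x i)" and "linear_functional K (omap (f i) c) l" and "l v = \<one>\<^bsub>K\<^esub>"
    and "\<And>u. u \<in> carrier (omap (f i) c) \<Longrightarrow>
      Comp C (x i) c (x i) q (w i c u) = mor_smult C (x i) (x i) (l u) (Idt C (x i))"
    and "\<And>j u. \<lbrakk>j \<in> I; j \<noteq> i; u \<in> carrier (omap (f j) c)\<rbrakk> \<Longrightarrow>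
      Comp C (x j) c (x i) q (w j c u) = mor_zero C (x j) (x i)"
proof -
  interpret V: field_module K "omap (f i) c" using f_field_module i c .
  interpret M: module K "mor_module C (x i) (x i)" using mor_module i by simp
  obtain l where l: "linear_functional K (omap (f i) c) l" "l v = \<one>\<^bsub>K\<^esub>"
    using V.separating_functional[OF v] by blast
  define h where "h j = (if j = i
    then (\<lambda>u \<in> carrier (omap (f i) c). mor_smult C (x i) (x i) (l u) (Idt C (x i)))
    else (\<lambda>u \<in> carrier (omap (f j) c). mor_zero C (x j) (x i)))" for j
  have "(\<lambda>u \<in> carrier (omap (f i) c). mor_smult C (x i) (x i) (l u) (Idt C (x i)))
    \<in> linear_maps K (omap (f i) c) (mor_module C (x i) (x i))"
    using i M.smult_l_distr[of _ _ "Idt C (x i)"] M.smult_assoc1[of _ _ "Idt C (x i)"]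
    by (intro linear_mapsI) (simp_all add: linear_functionalD[OF l(1)] Idt_closed)
  then have "h j \<in> linear_maps K (omap (f j) c) (mor_module C (x j) (x i))" if "j \<in> I" for j
    using that i c by (simp add: h_def zero_linear f_module)
  then obtain q where "q \<in> Mor C c (x i)"
    and q: "\<And>j u. \<lbrakk>j \<in> I; u \<in> carrier (omap (f j) c)\<rbrakk> \<Longrightarrow> Comp C (x j) c (x i) q (w j c u) = h j u"
    using w_universal[of c "x i" h] c i by auto
  then show ?thesis
    using l i by (intro that[of q l]) (simp_all add: h_def)
qed

text \<open>If \<open>w i c v\<close> vanished for a nonzero \<open>v\<close>, its retraction would
  make the identity of \<open>x i\<close> zero, which is excluded for active
  \<open>i\<close>.\<close>

lemma w_inj:
  assumes i: "i \<in> active" and c: "c \<in> Obj C"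
  shows "inj_on (w i c) (carrier (omap (f i) c))"
proof (rule linear_maps_inj_onI[OF f_module mor_module w_linear])
  fix v assume v: "v \<in> carrier (omap (f i) c)" "w i c v = \<zero>\<^bsub>mor_module C (x i) c\<^esub>"
  show "v = \<zero>\<^bsub>omap (f i) c\<^esub>"
  proof (rule ccontr)
    assume "v \<noteq> \<zero>\<^bsub>omap (f i) c\<^esub>"
    then obtain q l where q: "q \<in> Mor C c (x i)" "l v = \<one>\<^bsub>K\<^esub>"
      "Comp C (x i) c (x i) q (w i c v) = mor_smult C (x i) (x i) (l v) (Idt C (x i))"
      using retraction[OF activeD[OF i] c v(1)] v(1) by metis
    then have "mor_zero C (x i) (x i) = Idt C (x i)"
      using v c activeD[OF i] by (simp add: Comp_zero_right mor_smult_one Idt_closed)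
    then show False using i by (simp add: active_def)
  qed
qed (use i c activeD in auto)

text \<open>Composing \<open>r\<close> with the identity of \<open>x i\<close> is composing it with
  zero. This disposes of the indices with \<open>x i\<close> zero.\<close>

lemma zero_comp:
  assumes i: "i \<in> I" "Idt C (x i) = mor_zero C (x i) (x i)" and c: "c \<in> Obj C" and r: "r \<in> Mor C (x i) c"
  shows "r = mor_zero C (x i) c"
  using assms Comp_Idt_right[of "x i" c r] Comp_zero_right[of "x i" "x i" c r] by simp

text \<open>By uniqueness in \<open>w_universal\<close> it suffices to compare composites with all
  \<open>w i c v\<close>. Active indices are settled by naturality. For an inactive one, either
  \<open>x i\<close> is zero and so is every map out of it, or \<open>f i\<close> is zero and so is
  \<open>v\<close>.\<close>

lemma faithful:
  assumes c: "c \<in> Obj C" and d: "d \<in> Obj C" and a: "a \<in> Mor C c d" and b: "b \<in> Mor C c d"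
    and eq: "\<And>i. i \<in> active \<Longrightarrow> amap (f i) c d a = amap (f i) c d b"
  shows "a = b"
proof -
  have "Comp C (x i) c d a (w i c v) = Comp C (x i) c d b (w i c v)"
    if i: "i \<in> I" and v: "v \<in> carrier (omap (f i) c)" for i v
  proof (cases "i \<in> active")
    case True
    then show ?thesis using w_natural c d a b i v eq by simp
  next
    case False
    show ?thesis
    proof (cases "Idt C (x i) = mor_zero C (x i) (x i)")
      case True
      then show ?thesis using i v c d a b zero_comp Comp_closed by (metis w_closed x_closed)
    next
      case F: False
      then have "v = \<zero>\<^bsub>omap (f i) c\<^esub>" using False i c v by (auto simp: active_def)
      then show ?thesis using i c d a b by (simp add: w_zero Comp_zero_right)
    qed
  qed
  \<comment> \<open>The universal property applies to linear families only; this is the family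
    determined by \<open>b\<close>.\<close>
  moreover have "(\<lambda>v \<in> carrier (omap (f i) c). Comp C (x i) c d b (w i c v))
      \<in> linear_maps K (omap (f i) c) (mor_module C (x i) d)" if i: "i \<in> I" for i
    using i c d b module_closed[OF f_module[OF i c]] linear_mapsD(2)[OF w_linear[OF i c]]
    by (intro linear_mapsI) (simp_all add: Comp_closed Comp_add_right Comp_smult_right w_smult)
  ultimately show ?thesis
    using w_universal[OF c d, of "\<lambda>i. \<lambda>v \<in> carrier (omap (f i) c). Comp C (x i) c d b (w i c v)"] a b
    by (metis (no_types, lifting) restrict_apply')
qed

text \<open>Existence in \<open>w_universal\<close> for the family \<open>w i d (p i v)\<close>,
  extended by zero to the inactive indices, gives \<open>a\<close>; naturality and injectivity of
  \<open>w i d\<close> then identify its action with \<open>p i\<close>.\<close>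

lemma full:
  assumes c: "c \<in> Obj C" and d: "d \<in> Obj C"
    and p: "\<And>i. i \<in> active \<Longrightarrow> p i \<in> linear_maps K (omap (f i) c) (omap (f i) d)"
  shows "\<exists>a \<in> Mor C c d. \<forall>i \<in> active. amap (f i) c d a = p i"
proof -
  define h where "h i = (if i \<in> active then (\<lambda>v \<in> carrier (omap (f i) c). w i d (p i v))
    else (\<lambda>v \<in> carrier (omap (f i) c). mor_zero C (x i) d))" for i
  have "h i \<in> linear_maps K (omap (f i) c) (mor_module C (x i) d)" if i: "i \<in> I" for i
  proof (cases "i \<in> active")
    case True
    then show ?thesis
      unfolding h_def
      using i c d module_closed[OF f_module[OF i c]] linear_mapsD[OF w_linear[OF i d]]
        linear_mapsD[OF p[OF True]]
      by (simp, intro linear_mapsI) simp_all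
  next
    case False
    then show ?thesis using i c d by (simp add: h_def zero_linear f_module)
  qed
  then obtain a where a: "a \<in> Mor C c d"
    and aw: "\<And>i v. \<lbrakk>i \<in> I; v \<in> carrier (omap (f i) c)\<rbrakk> \<Longrightarrow> Comp C (x i) c d a (w i c v) = h i v"
    using w_universal[OF c d, of h] by auto
  have "amap (f i) c d a = p i" if i: "i \<in> active" for i
  proof (rule linear_maps_eqI[OF f_mor p])
    fix v assume v: "v \<in> carrier (omap (f i) c)"
    have "w i d (amap (f i) c d a v) = w i d (p i v)"
      using aw[of i v] w_natural[of i c d a v] i v c d a activeD by (simp add: h_def)
    then show "amap (f i) c d a v = p i v"
      using i v c d a activeD linear_mapsD(1)[OF p[OF i] v]
      by (intro inj_onD[OF w_inj[OF i d]]) auto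
  qed (use i c d a activeD in auto)
  then show ?thesis using a by blast
qed

text \<open>
  A nonzero \<open>v \<in> f\<^sub>i(c)\<close> makes \<open>x\<^sub>i\<close> a retract of \<open>c\<close>, by an idempotent that acts
  on \<open>f\<^sub>i(c)\<close> with rank one and on the other \<open>f\<^sub>j(c)\<close> as zero.
\<close>

lemma dual_at_x:
  assumes i: "i \<in> active"
  shows "\<exists>e. is_basis K (omap (f i) (x i)) {e}"
    and "\<And>j. \<lbrakk>j \<in> active; j \<noteq> i\<rbrakk> \<Longrightarrow> carrier (omap (f j) (x i)) = {\<zero>\<^bsub>omap (f j) (x i)\<^esub>}"
proof -
  note iI = activeD[OF i]
  obtain c v where c: "c \<in> Obj C" and v: "v \<in> carrier (omap (f i) c)" "v \<noteq> \<zero>\<^bsub>omap (f i) c\<^esub>"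
    using i by (auto simp: active_def)
  obtain q l where q: "q \<in> Mor C c (x i)" and l: "linear_functional K (omap (f i) c) l" "l v = \<one>\<^bsub>K\<^esub>"
    and qi: "\<And>u. u \<in> carrier (omap (f i) c) \<Longrightarrow>
      Comp C (x i) c (x i) q (w i c u) = mor_smult C (x i) (x i) (l u) (Idt C (x i))"
    and qj: "\<And>j u. \<lbrakk>j \<in> I; j \<noteq> i; u \<in> carrier (omap (f j) c)\<rbrakk> \<Longrightarrow>
      Comp C (x j) c (x i) q (w j c u) = mor_zero C (x j) (x i)"
    using retraction[OF iI c v] by blast
  define r where "r = w i c v"
  have r: "r \<in> Mor C (x i) c" using iI c v by (simp add: r_def)
  have qr: "Comp C (x i) c (x i) q r = Idt C (x i)"
    using qi[OF v(1)] iI l by (simp add: r_def mor_smult_one Idt_closed)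
  \<comment> \<open>Functoriality applied to \<open>qr\<close>: the map induced by \<open>q\<close>
    is a left inverse of the one induced by \<open>r\<close>.\<close>
  have ret: "amap (f j) c (x i) q (amap (f j) (x i) c r y) = y"
    if "j \<in> I" "y \<in> carrier (omap (f j) (x i))" for j y
    using that iI c q r by (simp add: f_Idt qr flip: f_Comp)
  \<comment> \<open>Elements in the image of the map induced by \<open>r\<close> are fixed by the
    idempotent \<open>r\<close> after \<open>q\<close>, so \<open>w\<close> at them factors through
    \<open>q\<close>, where \<open>qi\<close> and \<open>qj\<close> evaluate it.\<close>
  have wr: "w j c (amap (f j) (x i) c r y)
      = Comp C (x j) (x i) c r (Comp C (x j) c (x i) q (w j c (amap (f j) (x i) c r y)))"
    if "j \<in> I" "y \<in> carrier (omap (f j) (x i))" for j y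
    using that iI c q r by (simp add: w_natural ret)
  \<comment> \<open>For \<open>j\<close> other than \<open>i\<close>, composing with
    \<open>q\<close> gives zero, so the image of \<open>y\<close> under the injective map induced by
    \<open>r\<close> is zero.\<close>
  { fix j assume j: "j \<in> active" "j \<noteq> i"
    note jI = activeD[OF j(1)]
    have "y = \<zero>\<^bsub>omap (f j) (x i)\<^esub>" if y: "y \<in> carrier (omap (f j) (x i))" for y
    proof -
      let ?y = "amap (f j) (x i) c r y"
      have y': "?y \<in> carrier (omap (f j) c)" using y jI iI c r by simp
      have "w j c ?y = w j c \<zero>\<^bsub>omap (f j) c\<^esub>"
        using wr[OF jI y] qj[OF jI j(2) y'] jI iI c r by (simp add: w_zero Comp_zero_right)
      then have "?y = \<zero>\<^bsub>omap (f j) c\<^esub>"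
        using inj_onD[OF w_inj[OF j(1) c]] y' module_closed(1)[OF f_module[OF jI c]] by blast
      then show ?thesis
        using ret[OF jI y] linear_maps_zero[OF f_module f_module f_mor[OF jI c _ q]] jI c iI by simp
    qed
    then show "carrier (omap (f j) (x i)) = {\<zero>\<^bsub>omap (f j) (x i)\<^esub>}"
      using module_closed(1)[OF f_module[OF jI x_closed[OF iI]]] by blast }
  interpret V: field_module K "omap (f i) (x i)" using f_field_module iI by simp
  let ?e = "amap (f i) c (x i) q v"
  have e: "?e \<in> carrier (omap (f i) (x i))" using iI c q v by simp
  \<comment> \<open>Here \<open>q\<close> contributes the scalar \<open>l ?y\<close>, so
    \<open>?y\<close> is that multiple of \<open>v\<close>; the map induced by \<open>q\<close>
    carries this back to \<open>y\<close> and \<open>?e\<close>.\<close>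
  have span: "\<exists>a \<in> carrier K. y = a \<odot>\<^bsub>omap (f i) (x i)\<^esub> ?e" if y: "y \<in> carrier (omap (f i) (x i))" for y
  proof -
    let ?y = "amap (f i) (x i) c r y"
    have y': "?y \<in> carrier (omap (f i) c)" using y iI c r by simp
    note lK = linear_functionalD(1)[OF l(1) y']
    have lv: "l ?y \<odot>\<^bsub>omap (f i) c\<^esub> v \<in> carrier (omap (f i) c)"
      using module_closed(3)[OF f_module[OF iI c] lK v(1)] .
    have "w i c ?y = w i c (l ?y \<odot>\<^bsub>omap (f i) c\<^esub> v)"
      using wr[OF iI y] qi[OF y'] lK iI c r v
      by (simp add: Comp_smult_right Comp_Idt_right Idt_closed w_smult r_def)
    then have "?y = l ?y \<odot>\<^bsub>omap (f i) c\<^esub> v"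
      using inj_onD[OF w_inj[OF i c]] y' lv by blast
    then have "y = amap (f i) c (x i) q (l ?y \<odot>\<^bsub>omap (f i) c\<^esub> v)" using ret[OF iI y] by simp
    also have "\<dots> = l ?y \<odot>\<^bsub>omap (f i) (x i)\<^esub> ?e"
      using linear_mapsD(3)[OF f_mor[OF iI c _ q] lK v(1)] iI by simp
    finally show ?thesis using lK by blast
  qed
  \<comment> \<open>By naturality \<open>w i (x i) ?e\<close> is \<open>q\<close> after
    \<open>r\<close>, the identity of \<open>x i\<close>, which is nonzero.\<close>
  have "?e \<noteq> \<zero>\<^bsub>omap (f i) (x i)\<^esub>"
  proof
    assume "?e = \<zero>\<^bsub>omap (f i) (x i)\<^esub>"
    then have "mor_zero C (x i) (x i) = Comp C (x i) c (x i) q r"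
      using w_natural[OF iI c _ q v(1)] iI w_zero by (simp add: r_def)
    then show False using qr i by (simp add: active_def)
  qed
  moreover have "u = \<zero>\<^bsub>omap (f i) (x i)\<^esub>" if "u \<in> lspan K (omap (f i) (x i)) {}" for u
    using that by induction auto
  moreover have "y \<in> lspan K (omap (f i) (x i)) {?e}" if y: "y \<in> carrier (omap (f i) (x i))" for y
    using span[OF y] by (auto intro: lspan.intros)
  ultimately show "\<exists>e. is_basis K (omap (f i) (x i)) {e}"
    using e V.lspan_closed[of "{?e}"] unfolding is_basis_def by (intro exI[of _ ?e]) auto
qed

text \<open>As a left adjoint, \<open>f i\<close> preserves the coproduct. The summands with first
  index other than \<open>i\<close> become zero, and those indexed by \<open>(i, b)\<close> become
  lines, one for each element of the basis of \<open>V i\<close>.\<close>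

lemma dual_of_coproduct:
  assumes B: "\<And>i. i \<in> active \<Longrightarrow> is_basis K (V i) (B i)"
    and V: "\<And>i. i \<in> active \<Longrightarrow> V i \<in> Obj (Vect U K)"
    and c: "is_coproduct C (Sigma active B) (\<lambda>j. x (fst j)) c \<iota>"
    and i: "i \<in> active"
  shows "\<exists>h. is_iso (Vect U K) (omap (f i) c) (V i) h"
proof -
  note iI = activeD[OF i]
  let ?A = "\<lambda>j. omap (f i) (x (fst j))" and ?a = "\<lambda>j. amap (f i) (x (fst j)) c (\<iota> j)"
  have Vi: "module K (V i)" using V[OF i] by simp
  interpret V: field_module K "V i" using Vi by (intro field_module.intro field_axioms)
  have cO: "c \<in> Obj C" and \<iota>: "\<And>j. j \<in> Sigma active B \<Longrightarrow> \<iota> j \<in> Mor C (x (fst j)) c"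
    using is_coproductD[OF c] by auto
  have xO: "x (fst j) \<in> Obj C" if "j \<in> Sigma active B" for j using that activeD by auto
  obtain G where "is_adjunction C (Vect U K) (f i) G"
    using f_dual[OF iI] by (auto simp: dual_objects_def linear_left_adjoint_def)
  then have cop: "is_coproduct (Vect U K) (Sigma active B) ?A (omap (f i) c) ?a"
    using linear_category.axioms(1)[OF linear_category_Vect] c xO
    by (intro left_adjoint_preserves_coproduct) (auto intro: category_axioms)
  have am: "?a j \<in> linear_maps K (?A j) (omap (f i) c)" if "j \<in> Sigma active B" for j
    using f_mor[OF iI xO[OF that] cO \<iota>[OF that]] .
  obtain e where e: "is_basis K (omap (f i) (x i)) {e}" using dual_at_x(1)[OF i] by blast
  have eV: "e \<in> carrier (omap (f i) (x i))" using e by (auto simp: is_basis_def)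
  interpret E: field_module K "omap (f i) (x i)" using f_field_module iI by simp
  \<comment> \<open>The line spanned by \<open>e\<close> is mapped to \<open>V i\<close> with
    \<open>e\<close> going to \<open>b\<close>; these maps, and zero on the other summands, define
    \<open>h\<close> on the coproduct.\<close>
  have "\<exists>k. k \<in> linear_maps K (omap (f i) (x i)) (V i) \<and> k e = b" if "b \<in> B i" for b
    using E.linear_extension[OF e Vi, of "\<lambda>_. b"] B[OF i] that by (auto simp: is_basis_def)
  then obtain k where k: "\<And>b. b \<in> B i \<Longrightarrow> k b \<in> linear_maps K (omap (f i) (x i)) (V i)"
    "\<And>b. b \<in> B i \<Longrightarrow> k b e = b" by metis
  define \<kappa> where "\<kappa> j = (if fst j = i then k (snd j) else (\<lambda>v \<in> carrier (?A j). \<zero>\<^bsub>V i\<^esub>))" for j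
  have "\<kappa> j \<in> linear_maps K (?A j) (V i)" if j: "j \<in> Sigma active B" for j
  proof (cases "fst j = i")
    case True
    then show ?thesis using j k by (auto simp: \<kappa>_def)
  next
    case False
    have "(\<lambda>v \<in> carrier (?A j). \<zero>\<^bsub>V i\<^esub>) \<in> linear_maps K (?A j) (V i)"
      using module_closed[OF f_module[OF iI xO[OF j]]] by (intro linear_mapsI) simp_all
    then show ?thesis using False by (simp add: \<kappa>_def)
  qed
  then have "\<exists>!g. g \<in> Mor (Vect U K) (omap (f i) c) (V i) \<and>
      (\<forall>j \<in> Sigma active B. Comp (Vect U K) (?A j) (omap (f i) c) (V i) g (?a j) = \<kappa> j)"
    using V[OF i] by (intro is_coproductD(3)[OF cop]) auto
  then obtain h where h: "h \<in> linear_maps K (omap (f i) c) (V i)"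
    and h\<kappa>: "\<And>j. j \<in> Sigma active B \<Longrightarrow> compose (carrier (?A j)) h (?a j) = \<kappa> j"
    by auto
  \<comment> \<open>The inverse is defined on the basis: \<open>b\<close> goes to the copy of
    \<open>e\<close> in the summand \<open>(i, b)\<close>.\<close>
  have "(\<lambda>b. ?a (i, b) e) \<in> B i \<rightarrow> carrier (omap (f i) c)"
    using linear_mapsD(1)[OF am] eV i by auto
  from V.linear_extension[OF B[OF i] f_module[OF iI cO] this]
  obtain g where g: "g \<in> linear_maps K (V i) (omap (f i) c)"
    and gb: "\<And>b. b \<in> B i \<Longrightarrow> g b = ?a (i, b) e"
    by blast
  have BV: "B i \<subseteq> carrier (V i)" using B[OF i] by (auto simp: is_basis_def)
  have hg: "compose (carrier (V i)) h g = (\<lambda>v \<in> carrier (V i). v)"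
  proof (rule V.linear_maps_basis_eqI[OF B[OF i] Vi])
    fix b assume b: "b \<in> B i"
    have "h (?a (i, b) e) = \<kappa> (i, b) e"
      using h\<kappa>[of "(i, b)"] b i eV by (auto simp: compose_def dest: fun_cong[where x = e])
    then show "compose (carrier (V i)) h g b = (\<lambda>v \<in> carrier (V i). v) b"
      using b BV gb k by (auto simp: compose_def \<kappa>_def)
  qed (use g h Vi in \<open>simp_all add: linear_maps_compose linear_maps_id\<close>)
  \<comment> \<open>Both sides are endomorphisms of a coproduct, so they need only agree on each
    summand: on the generator \<open>e\<close> of a line, or trivially on a zero space.\<close>
  have gh: "compose (carrier (omap (f i) c)) g h = (\<lambda>v \<in> carrier (omap (f i) c). v)"
  proof -
    have lin: "compose (carrier (omap (f i) c)) g h \<in> linear_maps K (omap (f i) c) (omap (f i) c)"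
      "(\<lambda>v \<in> carrier (omap (f i) c). v) \<in> linear_maps K (omap (f i) c) (omap (f i) c)"
      using g h f_module[OF iI cO] by (simp_all add: linear_maps_compose linear_maps_id)
    have a_id: "compose (carrier (?A j)) (\<lambda>v \<in> carrier (omap (f i) c). v) (?a j) = ?a j"
      if "j \<in> Sigma active B" for j
      using linear_mapsD(1,4)[OF am[OF that]] by (intro Id_compose) auto
    have a_gh: "compose (carrier (?A j)) (compose (carrier (omap (f i) c)) g h) (?a j) = ?a j"
      if j: "j \<in> Sigma active B" for j
    proof -
      have mod: "module K (?A j)" using f_module[OF iI xO[OF j]] .
      have l: "compose (carrier (?A j)) (compose (carrier (omap (f i) c)) g h) (?a j)
        \<in> linear_maps K (?A j) (omap (f i) c)"
        using linear_maps_compose[OF mod am[OF j] lin(1)] .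
      show ?thesis
      proof (cases "fst j = i")
        case True
        then obtain b where jb: "j = (i, b)" "b \<in> B i" using j by (cases j) auto
        have "h (?a (i, b) e) = \<kappa> (i, b) e"
          using h\<kappa>[of "(i, b)"] jb i eV by (auto simp: compose_def dest: fun_cong[where x = e])
        then have "compose (carrier (?A j)) (compose (carrier (omap (f i) c)) g h) (?a j) e = ?a j e"
          using jb eV linear_mapsD(1)[OF am[OF j], of e] gb k by (simp add: compose_def \<kappa>_def)
        moreover have "is_basis K (?A j) {e}" "field_module K (?A j)"
          using e jb E.field_module_axioms by simp_all
        ultimately show ?thesis
          using field_module.linear_maps_basis_eqI[of K "?A j" "{e}", OF _ _ f_module[OF iI cO] l am[OF j]]
          by simp
      next
        case False
        then have z: "carrier (?A j) = {\<zero>\<^bsub>?A j\<^esub>}" using dual_at_x(2)[of "fst j" i] i j by auto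
        show ?thesis
        proof (rule linear_maps_eqI[OF l am[OF j]])
          fix y assume "y \<in> carrier (?A j)"
          then have "y = \<zero>\<^bsub>?A j\<^esub>" using z by simp
          then show "compose (carrier (?A j)) (compose (carrier (omap (f i) c)) g h) (?a j) y = ?a j y"
            using linear_maps_zero[OF mod f_module[OF iI cO] l]
              linear_maps_zero[OF mod f_module[OF iI cO] am[OF j]] by simp
        qed
      qed
    qed
    have "\<exists>!g. g \<in> Mor (Vect U K) (omap (f i) c) (omap (f i) c) \<and>
      (\<forall>j \<in> Sigma active B. Comp (Vect U K) (?A j) (omap (f i) c) (omap (f i) c) g (?a j) = ?a j)"
      using f_obj[OF iI cO] am by (intro is_coproductD(3)[OF cop]) auto
    then show ?thesis by (rule ex1_implies_unique) (use lin a_id a_gh in simp_all)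
  qed
  show ?thesis
    using g h hg gh by (auto simp: is_iso_def intro!: exI[of _ h] bexI[of _ g])
qed

end

section \<open>The comparison functor to a product of copies of \<open>Vect\<close>\<close>

context dual_decomposition
begin

text \<open>The restriction to active indices matters: a zero \<open>f i\<close> reaches no nonzero
  space, and an \<open>f i\<close> paired with a zero object is not controlled by the
  decomposition.\<close>

definition dual_functor :: "('o, 'm, 'i \<Rightarrow> ('k, 'u) module, 'i \<Rightarrow> 'u \<Rightarrow> 'u) cat_functor" where
  "dual_functor = \<lparr>omap = (\<lambda>c. \<lambda>i \<in> active. omap (f i) c),
    amap = (\<lambda>c d a. \<lambda>i \<in> active. amap (f i) c d a)\<rparr>"

lemma dual_functor_linear: "is_linear_functor K C (coproduct_of_Vect U K active) dual_functor"
proof -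
  have F: "is_functor C (coproduct_of_Vect U K active) dual_functor"
    unfolding is_functor_def coproduct_of_Vect_def dual_functor_def
    using f_obj f_mor is_functorD(3,4)[OF f_functor] activeD
    by (auto intro!: restrict_ext simp: PiE_iff)
  have lin: "restrict (amap (f i) c d) (Mor C c d)
      \<in> linear_maps K (mor_module C c d) (mor_module (Vect U K) (omap (f i) c) (omap (f i) d))"
    if "i \<in> active" "c \<in> Obj C" "d \<in> Obj C" for i c d
    using f_linear[OF activeD] that unfolding is_linear_functor_def by blast
  note lin = linear_mapsD(2,3)[OF lin, simplified]
  show ?thesis
    unfolding is_linear_functor_def
  proof (intro conjI F ballI linear_mapsI)
    fix c d assume c: "c \<in> Obj C" and d: "d \<in> Obj C"
    let ?M = "mor_module (coproduct_of_Vect U K active) (omap dual_functor c) (omap dual_functor d)"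
    show "restrict (amap dual_functor c d) (Mor C c d) a \<in> carrier ?M"
      if "a \<in> carrier (mor_module C c d)" for a
      using that is_functorD(2)[OF F c d] by simp
    show "restrict (amap dual_functor c d) (Mor C c d) (a \<oplus>\<^bsub>mor_module C c d\<^esub> b)
      = restrict (amap dual_functor c d) (Mor C c d) a \<oplus>\<^bsub>?M\<^esub>
        restrict (amap dual_functor c d) (Mor C c d) b"
      if "a \<in> carrier (mor_module C c d)" "b \<in> carrier (mor_module C c d)" for a b
      using that c d lin(1)[OF _ c d]
      by (auto simp: dual_functor_def coproduct_of_Vect_def intro!: restrict_ext)
    show "restrict (amap dual_functor c d) (Mor C c d) (t \<odot>\<^bsub>mor_module C c d\<^esub> a)
      = t \<odot>\<^bsub>?M\<^esub> restrict (amap dual_functor c d) (Mor C c d) a"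
      if "t \<in> carrier K" "a \<in> carrier (mor_module C c d)" for t a
      using that c d lin(2)[OF _ c d]
      by (auto simp: dual_functor_def coproduct_of_Vect_def intro!: restrict_ext)
  qed simp
qed

text \<open>Full faithfulness is \<open>faithful\<close> and \<open>full\<close>. To reach a family
  \<open>V\<close>, choose a basis of each \<open>V i\<close> and form the coproduct in
  \<open>C\<close> with one copy of \<open>x i\<close> for every basis element; the bases are small,
  hence so is the index set of that coproduct.\<close>

lemma equivalent_to_coproduct_of_Vect:
  assumes U: "universe U" and co: "cocomplete U C" and I: "small U I"
  shows "two_module_equivalent K C (coproduct_of_Vect U K active)"
proof -
  let ?D = "coproduct_of_Vect U K active"
  have "linear_category ?D K"
    unfolding coproduct_of_Vect_def
    by (intro linear_category_prod linear_category_Vect is_cring)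
  moreover have "inj_on (amap dual_functor c d) (Mor C c d)" if "c \<in> Obj C" "d \<in> Obj C" for c d
  proof (rule inj_onI)
    fix a b assume ab: "a \<in> Mor C c d" "b \<in> Mor C c d" "amap dual_functor c d a = amap dual_functor c d b"
    have "amap (f i) c d a = amap (f i) c d b" if "i \<in> active" for i
      using fun_cong[OF ab(3), of i] that by (simp add: dual_functor_def)
    then show "a = b" using faithful[OF that ab(1,2)] by blast
  qed
  moreover have "h \<in> amap dual_functor c d ` Mor C c d"
    if c: "c \<in> Obj C" "d \<in> Obj C" and h: "h \<in> Mor ?D (omap dual_functor c) (omap dual_functor d)" for c d h
  proof -
    have h': "h \<in> (\<Pi>\<^sub>E i \<in> active. linear_maps K (omap (f i) c) (omap (f i) d))"
      using h by (auto simp: coproduct_of_Vect_def dual_functor_def PiE_iff)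
    then obtain a where "a \<in> Mor C c d" "\<forall>i \<in> active. amap (f i) c d a = h i"
      using full[OF c, of h] by (auto simp: PiE_iff)
    moreover from this h' have "h = amap dual_functor c d a"
      by (auto simp: dual_functor_def PiE_iff intro!: extensionalityI[of h active])
    ultimately show ?thesis by blast
  qed
  moreover have "\<exists>c \<in> Obj C. \<exists>b. is_iso ?D (omap dual_functor c) V b" if V: "V \<in> Obj ?D" for V
  proof -
    have Vi: "V i \<in> Obj (Vect U K)" if "i \<in> active" for i
      using V that by (auto simp: coproduct_of_Vect_def PiE_iff)
    have "\<exists>B. is_basis K (V i) B" if "i \<in> active" for i
      using Vi[OF that] by (intro field_module.basis_exists field_module.intro field_axioms) simp
    then obtain B where B: "\<And>i. i \<in> active \<Longrightarrow> is_basis K (V i) (B i)" by metis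
    have "small U (B i)" if "i \<in> active" for i
      using B[OF that] Vi[OF that] by (auto simp: is_basis_def intro: small_subset)
    then have "small U (Sigma active B)"
      using I activeD by (intro small_Sigma[OF U] small_subset[OF I]) auto
    then obtain c \<iota> where c: "is_coproduct C (Sigma active B) (\<lambda>j. x (fst j)) c \<iota>"
      using coproduct_exists[OF category_axioms co U, of "Sigma active B" "\<lambda>j. x (fst j)"] activeD by auto
    have "\<exists>h. is_iso (Vect U K) (omap (f i) c) (V i) h" if "i \<in> active" for i
      using dual_of_coproduct[OF B Vi c that] .
    then obtain h where "\<And>i. i \<in> active \<Longrightarrow> is_iso (Vect U K) (omap (f i) c) (V i) (h i)" by metis
    then have "is_iso ?D (omap dual_functor c) V (restrict h active)"
      unfolding coproduct_of_Vect_def by (intro is_iso_prod) (simp add: dual_functor_def)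
    then show ?thesis using is_coproductD(1)[OF c] by blast
  qed
  ultimately show ?thesis
    by (intro linear_equivalence.two_module_equivalent[of C ?D K dual_functor]
      linear_equivalence.intro linear_equivalence_axioms.intro dual_functor_linear linear_category_axioms)
qed

end

text \<open>Each ingredient of \<open>w\<close> is natural, hence so is \<open>w\<close>. For the
  universal property, the copowers turn \<open>h i\<close> into maps from \<open>T i c\<close> to
  \<open>d\<close>, the coproduct assembles them into a map from \<open>G c\<close>, and the
  isomorphism \<open>\<tau>\<close> moves its source to \<open>c\<close>.\<close>

lemma identity_decomposes_imp_dual_decomposition:
  assumes C: "linear_category C K" and K: "field K" and dec: "identity_decomposes K C I x f"
    and x: "\<And>i. i \<in> I \<Longrightarrow> x i \<in> Obj C" and dual: "\<And>i. i \<in> I \<Longrightarrow> f i \<in> dual_objects U K C"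
  shows "\<exists>w. dual_decomposition C K U I x f w"
proof -
  interpret linear_category C K by (rule C)
  have f: "is_functor C (Vect U K) (f i)" if "i \<in> I" for i
    using dual[OF that]
    by (auto simp: dual_objects_def linear_left_adjoint_def is_linear_functor_def)
  obtain T G where T: "\<And>i. i \<in> I \<Longrightarrow> is_tensor_functor K C (x i) (f i) (T i)"
    and G: "is_functor_coproduct C C I T G" and iso: "nat_isomorphic C C id_functor G"
    using dec by (auto simp: identity_decomposes_def)
  have Tf: "is_functor C C (T i)" if "i \<in> I" for i
    using T[OF that] by (simp add: is_tensor_functor_def)
  have Gf: "is_functor C C G" using G by (simp add: is_functor_coproduct_def)
  have "\<exists>u. (\<forall>c \<in> Obj C. is_copower K C (x i) (omap (f i) c) (omap (T i) c) (u c)) \<and>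
    (\<forall>c \<in> Obj C. \<forall>d \<in> Obj C. \<forall>a \<in> Mor C c d. \<forall>v \<in> carrier (omap (f i) c).
      Comp C (x i) (omap (T i) c) (omap (T i) d) (amap (T i) c d a) (u c v) = u d (amap (f i) c d a v))"
    if "i \<in> I" for i using T[OF that] by (simp add: is_tensor_functor_def)
  then obtain u where
    cop: "\<And>i c. \<lbrakk>i \<in> I; c \<in> Obj C\<rbrakk> \<Longrightarrow> is_copower K C (x i) (omap (f i) c) (omap (T i) c) (u i c)"
    and u_nat: "\<And>i c d a v. \<lbrakk>i \<in> I; c \<in> Obj C; d \<in> Obj C; a \<in> Mor C c d; v \<in> carrier (omap (f i) c)\<rbrakk> \<Longrightarrow>
      Comp C (x i) (omap (T i) c) (omap (T i) d) (amap (T i) c d a) (u i c v) = u i d (amap (f i) c d a v)"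
    by metis
  obtain \<iota> where \<iota>: "\<And>i. i \<in> I \<Longrightarrow> is_nat_trans C C (T i) G (\<iota> i)"
    and Gc: "\<And>c. c \<in> Obj C \<Longrightarrow> is_coproduct C I (\<lambda>i. omap (T i) c) (omap G c) (\<lambda>i. \<iota> i c)"
    using G by (auto simp: is_functor_coproduct_def)
  obtain \<tau> where \<tau>: "is_nat_trans C C id_functor G \<tau>"
    "\<And>c. c \<in> Obj C \<Longrightarrow> is_iso C c (omap G c) (\<tau> c)"
    using iso by (auto simp: nat_isomorphic_def id_functor_def)
  have "\<exists>s. s \<in> Mor C (omap G c) c \<and> Comp C c (omap G c) c s (\<tau> c) = Idt C c \<and>
      Comp C (omap G c) c (omap G c) (\<tau> c) s = Idt C (omap G c)" if "c \<in> Obj C" for c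
    using \<tau>(2)[OF that] by (auto simp: is_iso_def)
  then obtain \<sigma> where \<sigma> [simp]: "\<And>c. c \<in> Obj C \<Longrightarrow> \<sigma> c \<in> Mor C (omap G c) c"
    and \<sigma>\<tau>: "\<And>c. c \<in> Obj C \<Longrightarrow> Comp C c (omap G c) c (\<sigma> c) (\<tau> c) = Idt C c"
    and \<tau>\<sigma>: "\<And>c. c \<in> Obj C \<Longrightarrow> Comp C (omap G c) c (omap G c) (\<tau> c) (\<sigma> c) = Idt C (omap G c)"
    by metis
  have \<tau>_mor [simp]: "\<tau> c \<in> Mor C c (omap G c)" if "c \<in> Obj C" for c
    using \<tau>(2)[OF that] by (simp add: is_iso_def)
  have \<tau>_nat: "Comp C c d (omap G d) (\<tau> d) a = Comp C c (omap G c) (omap G d) (amap G c d a) (\<tau> c)"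
    if "c \<in> Obj C" "d \<in> Obj C" "a \<in> Mor C c d" for c d a
    using \<tau>(1) that by (simp add: is_nat_trans_def id_functor_def)
  have \<iota>_mor [simp]: "\<iota> i c \<in> Mor C (omap (T i) c) (omap G c)" if "i \<in> I" "c \<in> Obj C" for i c
    using \<iota>[OF that(1)] that by (simp add: is_nat_trans_def)
  have \<iota>_nat: "Comp C (omap (T i) c) (omap (T i) d) (omap G d) (\<iota> i d) (amap (T i) c d a)
      = Comp C (omap (T i) c) (omap G c) (omap G d) (amap G c d a) (\<iota> i c)"
    if "i \<in> I" "c \<in> Obj C" "d \<in> Obj C" "a \<in> Mor C c d" for i c d a
    using \<iota>[OF that(1)] that by (simp add: is_nat_trans_def)
  have u_lin: "u i c \<in> linear_maps K (omap (f i) c) (mor_module C (x i) (omap (T i) c))"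
    if "i \<in> I" "c \<in> Obj C" for i c
    using cop[OF that] by (simp add: is_copower_def)
  note [simp] = Idt_closed Comp_closed Comp_Idt_left Comp_Idt_right
    is_functorD(1,2)[OF Tf] is_functorD(1,2)[OF Gf] x
  have u [simp]: "u i c v \<in> Mor C (x i) (omap (T i) c)"
    if "i \<in> I" "c \<in> Obj C" "v \<in> carrier (omap (f i) c)" for i c v
    using linear_mapsD(1)[OF u_lin] that by simp
  have fv [simp]: "amap (f i) c d a v \<in> carrier (omap (f i) d)"
    if "i \<in> I" "c \<in> Obj C" "d \<in> Obj C" "a \<in> Mor C c d" "v \<in> carrier (omap (f i) c)" for i c d a v
    using is_functorD(2)[OF f[OF that(1)] that(2,3,4)] that(5) by (simp add: linear_mapsD(1))
  \<comment> \<open>The given isomorphism runs from the identity to \<open>G\<close>, while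
    \<open>w\<close> needs the reverse direction; the pointwise inverse of a natural isomorphism is
    natural.\<close>
  have \<sigma>_nat: "Comp C (omap G c) (omap G d) d (\<sigma> d) (amap G c d a) = Comp C (omap G c) c d a (\<sigma> c)"
    if cd: "c \<in> Obj C" "d \<in> Obj C" "a \<in> Mor C c d" for c d a
  proof -
    have "Comp C (omap G c) (omap G d) d (\<sigma> d) (amap G c d a)
      = Comp C (omap G c) (omap G d) d (\<sigma> d)
          (Comp C (omap G c) c (omap G d) (Comp C c (omap G c) (omap G d) (amap G c d a) (\<tau> c)) (\<sigma> c))"
      using cd by (simp add: Comp_assoc \<tau>\<sigma>)
    also have "\<dots> = Comp C (omap G c) (omap G d) d (\<sigma> d)
          (Comp C (omap G c) c (omap G d) (Comp C c d (omap G d) (\<tau> d) a) (\<sigma> c))"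
      using cd by (simp only: \<tau>_nat)
    also have "\<dots> = Comp C (omap G c) c d (Comp C c d d (Comp C d (omap G d) d (\<sigma> d) (\<tau> d)) a) (\<sigma> c)"
      using cd by (simp add: Comp_assoc del: Comp_Idt_left)
    also have "\<dots> = Comp C (omap G c) c d a (\<sigma> c)" using cd by (simp add: \<sigma>\<tau>)
    finally show ?thesis .
  qed
  \<comment> \<open>The inclusion of the summand \<open>T i c\<close> into \<open>c\<close>
    itself.\<close>
  define j where "j i c = Comp C (omap (T i) c) (omap G c) c (\<sigma> c) (\<iota> i c)" for i c
  have j [simp]: "j i c \<in> Mor C (omap (T i) c) c" if "i \<in> I" "c \<in> Obj C" for i c
    using that by (simp add: j_def)
  have j_nat: "Comp C (omap (T i) c) (omap (T i) d) d (j i d) (amap (T i) c d a)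
      = Comp C (omap (T i) c) c d a (j i c)"
    if cd: "i \<in> I" "c \<in> Obj C" "d \<in> Obj C" "a \<in> Mor C c d" for i c d a
  proof -
    have "Comp C (omap (T i) c) (omap (T i) d) d (j i d) (amap (T i) c d a)
      = Comp C (omap (T i) c) (omap G c) d (Comp C (omap G c) (omap G d) d (\<sigma> d) (amap G c d a)) (\<iota> i c)"
      using cd by (simp add: j_def Comp_assoc \<iota>_nat)
    then show ?thesis using cd by (simp add: \<sigma>_nat j_def Comp_assoc)
  qed
  define w where "w i c = (\<lambda>v \<in> carrier (omap (f i) c). Comp C (x i) (omap (T i) c) c (j i c) (u i c v))"
    for i c
  show ?thesis
  proof (intro exI[of _ w] dual_decomposition.intro dual_decomposition_axioms.intro C K x dual)
    fix i c assume i: "i \<in> I" and c: "c \<in> Obj C"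
    have mod: "module K (omap (f i) c)" using is_functorD(1)[OF f[OF i] c] by simp
    show "w i c \<in> linear_maps K (omap (f i) c) (mor_module C (x i) c)"
      using i c linear_mapsD(2,3)[OF u_lin[OF i c]] module_closed[OF mod] unfolding w_def
      by (intro linear_mapsI) (simp_all add: Comp_add_right Comp_smult_right)
    fix d a v assume "d \<in> Obj C" "a \<in> Mor C c d" "v \<in> carrier (omap (f i) c)"
    then show "Comp C (x i) c d a (w i c v) = w i d (amap (f i) c d a v)"
      using i c by (simp add: w_def flip: Comp_assoc j_nat u_nat)
  next
    fix c d h assume c: "c \<in> Obj C" and d: "d \<in> Obj C"
      and h: "\<And>i. i \<in> I \<Longrightarrow> h i \<in> linear_maps K (omap (f i) c) (mor_module C (x i) d)"
    have bij: "bij_betw (\<lambda>g. \<lambda>v \<in> carrier (omap (f i) c). Comp C (x i) (omap (T i) c) d g (u i c v))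
      (Mor C (omap (T i) c) d) (linear_maps K (omap (f i) c) (mor_module C (x i) d))" if "i \<in> I" for i
      using cop[OF that c] d by (simp add: is_copower_def)
    have "\<exists>k. k \<in> Mor C (omap (T i) c) d \<and>
      (\<lambda>v \<in> carrier (omap (f i) c). Comp C (x i) (omap (T i) c) d k (u i c v)) = h i" if i: "i \<in> I" for i
      using h[OF i] unfolding bij_betw_imp_surj_on[OF bij[OF i], symmetric] by auto
    then obtain k where k: "\<And>i. i \<in> I \<Longrightarrow> k i \<in> Mor C (omap (T i) c) d"
      and kh: "\<And>i. i \<in> I \<Longrightarrow>
        (\<lambda>v \<in> carrier (omap (f i) c). Comp C (x i) (omap (T i) c) d (k i) (u i c v)) = h i"
      by metis
    have kv: "Comp C (x i) (omap (T i) c) d (k i) (u i c v) = h i v"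
      if "i \<in> I" "v \<in> carrier (omap (f i) c)" for i v
      using fun_cong[OF kh[OF that(1)], of v] that(2) by simp
    \<comment> \<open>Injectivity of the copower bijection replaces the conditions for all
      \<open>v\<close> by one equation between morphisms.\<close>
    have iff: "(\<forall>v \<in> carrier (omap (f i) c). Comp C (x i) (omap (T i) c) d g (u i c v) = h i v) \<longleftrightarrow> g = k i"
      if i: "i \<in> I" and g: "g \<in> Mor C (omap (T i) c) d" for i g
    proof
      assume "\<forall>v \<in> carrier (omap (f i) c). Comp C (x i) (omap (T i) c) d g (u i c v) = h i v"
      then have "(\<lambda>v \<in> carrier (omap (f i) c). Comp C (x i) (omap (T i) c) d g (u i c v))
        = (\<lambda>v \<in> carrier (omap (f i) c). Comp C (x i) (omap (T i) c) d (k i) (u i c v))"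
        using kv[OF i] by (intro restrict_ext) simp
      then show "g = k i" using inj_onD[OF bij_betw_imp_inj_on[OF bij[OF i]]] g k[OF i] by blast
    next
      assume "g = k i"
      then show "\<forall>v \<in> carrier (omap (f i) c). Comp C (x i) (omap (T i) c) d g (u i c v) = h i v"
        using kv[OF i] by simp
    qed
    \<comment> \<open>The condition on \<open>a\<close> becomes the coproduct condition on
      \<open>a\<close> after \<open>\<sigma> c\<close>; thus the solution is \<open>g\<close> after
      \<open>\<tau> c\<close>.\<close>
    have cond: "(\<forall>v \<in> carrier (omap (f i) c). Comp C (x i) c d a (w i c v) = h i v) \<longleftrightarrow>
        Comp C (omap (T i) c) (omap G c) d (Comp C (omap G c) c d a (\<sigma> c)) (\<iota> i c) = k i"
      if i: "i \<in> I" and a: "a \<in> Mor C c d" for i a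
      using i a c d by (simp add: w_def j_def Comp_assoc flip: iff)
    have "\<exists>!g. g \<in> Mor C (omap G c) d \<and>
        (\<forall>i \<in> I. Comp C (omap (T i) c) (omap G c) d g (\<iota> i c) = k i)"
      using d k by (intro is_coproductD(3)[OF Gc[OF c]]) auto
    then obtain g where g': "g \<in> Mor C (omap G c) d \<and>
        (\<forall>i \<in> I. Comp C (omap (T i) c) (omap G c) d g (\<iota> i c) = k i)"
      and uniq: "\<forall>g'. g' \<in> Mor C (omap G c) d \<and>
        (\<forall>i \<in> I. Comp C (omap (T i) c) (omap G c) d g' (\<iota> i c) = k i) \<longrightarrow> g' = g"
      by (rule ex1E)
    have g: "g \<in> Mor C (omap G c) d"
        "\<And>i. i \<in> I \<Longrightarrow> Comp C (omap (T i) c) (omap G c) d g (\<iota> i c) = k i"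
      using g' by auto
    show "\<exists>!a. a \<in> Mor C c d \<and>
        (\<forall>i \<in> I. \<forall>v \<in> carrier (omap (f i) c). Comp C (x i) c d a (w i c v) = h i v)"
    proof (rule ex1I[of _ "Comp C c (omap G c) d g (\<tau> c)"])
      have "Comp C (omap G c) c d (Comp C c (omap G c) d g (\<tau> c)) (\<sigma> c) = g"
        using g c d by (simp add: Comp_assoc \<tau>\<sigma>)
      then show "Comp C c (omap G c) d g (\<tau> c) \<in> Mor C c d \<and> (\<forall>i \<in> I. \<forall>v \<in> carrier (omap (f i) c).
          Comp C (x i) c d (Comp C c (omap G c) d g (\<tau> c)) (w i c v) = h i v)"
        using g c d cond[of _ "Comp C c (omap G c) d g (\<tau> c)"] by simp
      fix a assume a: "a \<in> Mor C c d \<and>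
        (\<forall>i \<in> I. \<forall>v \<in> carrier (omap (f i) c). Comp C (x i) c d a (w i c v) = h i v)"
      then have "Comp C (omap G c) c d a (\<sigma> c) = g" using cond c d by (intro uniq[rule_format]) auto
      then have "Comp C c (omap G c) d g (\<tau> c)
        = Comp C c (omap G c) d (Comp C (omap G c) c d a (\<sigma> c)) (\<tau> c)" by simp
      also have "\<dots> = a" using a c d by (simp add: Comp_assoc \<sigma>\<tau>)
      finally show "a = Comp C c (omap G c) d g (\<tau> c)" by simp
    qed
  qed
qed

theorem theorem0p2:
  fixes U :: "'u set"
    and K :: "'k ring"
    and C :: "('o, 'm, 'k) lin_cat"
    and I :: "'i set"
    and x :: "'i \<Rightarrow> 'o"
    and f :: "'i \<Rightarrow> ('o, 'm, ('k, 'u) module, 'u \<Rightarrow> 'u) cat_functor"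
  assumes "universe U"
    and "field K" and "small U (carrier K)"
    and "two_module U K C"
    and "small U I"
    and "\<And>i. i \<in> I \<Longrightarrow> x i \<in> Obj C"
    and "\<And>i. i \<in> I \<Longrightarrow> f i \<in> dual_objects U K C"
    and "identity_decomposes K C I x f"
  shows "\<exists>S :: 'u set. S \<subseteq> U \<and> small U S \<and>
    two_module_equivalent K C (coproduct_of_Vect U K S)"
proof -
  have C: "linear_category C K" and co: "cocomplete U C"
    using assms(4) by (auto simp: two_module_def locally_presentable_def)
  obtain w where "dual_decomposition C K U I x f w"
    using identity_decomposes_imp_dual_decomposition[OF C assms(2,8,6,7)] by blast
  then interpret D: dual_decomposition C K U I x f w .
  \<comment> \<open>The index set has arbitrary type, whereas the copies of \<open>Vect\<close> are
    to be indexed by a subset of \<open>U\<close>. The decomposition is therefore reindexed along an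
    injection into \<open>U\<close>, and the active indices of the new family serve as
    \<open>S\<close>.\<close>
  obtain e where e: "inj_on e I" "e ` I \<subseteq> U" using small_embedding[OF assms(5)] .
  let ?n = "inv_into I e"
  have n: "?n p \<in> I" if "p \<in> e ` I" for p using that by (rule inv_into_into)
  interpret E: dual_decomposition C K U "e ` I" "\<lambda>p. x (?n p)" "\<lambda>p. f (?n p)" "\<lambda>p. w (?n p)"
  proof (intro dual_decomposition.intro dual_decomposition_axioms.intro C assms(2))
    fix c d h assume c: "c \<in> Obj C" and d: "d \<in> Obj C" and h: "\<And>p. p \<in> e ` I \<Longrightarrow>
      h p \<in> linear_maps K (omap (f (?n p)) c) (mor_module C (x (?n p)) d)"
    have "h (e i) \<in> linear_maps K (omap (f i) c) (mor_module C (x i) d)" if "i \<in> I" for i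
      using h[of "e i"] e that by simp
    then have "\<exists>!a. a \<in> Mor C c d \<and>
        (\<forall>i \<in> I. \<forall>v \<in> carrier (omap (f i) c). Comp C (x i) c d a (w i c v) = h (e i) v)"
      by (intro D.w_universal[OF c d])
    then show "\<exists>!a. a \<in> Mor C c d \<and> (\<forall>p \<in> e ` I. \<forall>v \<in> carrier (omap (f (?n p)) c).
        Comp C (x (?n p)) c d a (w (?n p) c v) = h p v)"
      using e by simp
  qed (use n in \<open>simp_all add: D.f_dual D.w_linear D.w_natural\<close>)
  have "E.active \<subseteq> e ` I" using E.activeD by blast
  then have "E.active \<subseteq> U" "small U E.active"
    using e small_subset small_image[OF assms(5)] by blast+
  moreover have "two_module_equivalent K C (coproduct_of_Vect U K E.active)"
    by (intro E.equivalent_to_coproduct_of_Vect assms(1) co small_image assms(5))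
  ultimately show ?thesis by blast
qed

end
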